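(* Let $\alpha\in(0,1)$, let $\mathcal{H}$ be a (complex) Hilbert space and let $A$ be a positive self-adjoint operator on $\mathcal{H}$, written as $A=WM_aW^{-1}$ by the spectral theorem, and let $U_\alpha(t)=W\,E_{\alpha}((-it)^{\alpha}a(\cdot))\,W^{-1}$, $t\ge0$. Then: (i) $U_{\alpha}(t)^*=W\,E_{\alpha}((it)^{\alpha}a(\cdot))\,W^{-1}$ for all $t>0$. (ii) $U_{\alpha}(t)U_{\alpha}(t)^*=U_{\alpha}(t)^*U_{\alpha}(t)=W\,|E_{\alpha}((it)^{\alpha}a(\cdot))|^2\,W^{-1}$ for all $t>0$. (iii) If $e^{-itA}$ denotes the unitary group generated by the self-adjoint operator $A$, then $$\lim_{\alpha\to1^-}U_{\alpha}(t)\phi=e^{-itA}\phi\quad\text{in }\mathcal{H},\qquad\text{for every }\phi\in\mathcal{H}\text{ and every }t\ge0.$$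
   Context: Positive self-adjoint means: densely defined, possibly unbounded, self-adjoint, with $(Ax,x)\ge0$ for all $x\in D(A)$. By the spectral theorem fix a measure space $(\Omega,\mu)$, a real-valued measurable function $a$ on $\Omega$ (with $a\ge0$ a.e., as $A$ is positive) and a unitary map $W:L^2(\Omega,\mu)\to\mathcal{H}$ such that, for $f\in L^2(\Omega,\mu)$, $Wf\in D(A)$ if and only if $af\in L^2(\Omega,\mu)$, and then $W^{-1}AWf=M_af=af$. These data do not depend on $\alpha$. Notation: $(-it)^{\alpha}=e^{-i\alpha\pi/2}t^{\alpha}$ and $(it)^{\alpha}=e^{i\alpha\pi/2}t^{\alpha}$ for $t\ge0$. The Mittag-Leffler function is $E_{\alpha}(z)=\sum_{k=0}^{\infty}\frac{z^k}{\Gamma(\alpha k+1)}$, $z\in\mathbb{C}$. In the formulas, a function of $a(\cdot)$ placed between $W$ and $W^{-1}$ stands for the operator of pointwise multiplication by that function on $L^2(\Omega,\mu)$. The family $\{U_\alpha(t)\}_{t\ge0}$ is the solution operator family of the problem $D^\alpha u=(-i)^\alpha Au$, $u(0)=u_0$ (Caputo derivative). *)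

theory Defs
  imports "HOL-Analysis.Analysis"
begin

text \<open>
  Complex Hilbert spaces, built on the library's real inner product spaces: the real inner product
  is the real part of the complex one, so norm and topology are those of \<open>cinner\<close>.
  The complex inner product is linear in its first argument.
\<close>

class complex_hilbert_space = real_inner + complete_space +
  fixes scaleC :: "complex \<Rightarrow> 'a \<Rightarrow> 'a"  (infixr \<open>*\<^sub>C\<close> 75)
    and cinner :: "'a \<Rightarrow> 'a \<Rightarrow> complex"
  assumes scaleC_of_real: "complex_of_real r *\<^sub>C x = r *\<^sub>R x"
    and scaleC_add_right: "c *\<^sub>C (x + y) = c *\<^sub>C x + c *\<^sub>C y"
    and scaleC_add_left: "(c + d) *\<^sub>C x = c *\<^sub>C x + d *\<^sub>C x"
    and scaleC_scaleC: "c *\<^sub>C d *\<^sub>C x = (c * d) *\<^sub>C x"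
    and cinner_commute: "cinner x y = cnj (cinner y x)"
    and cinner_add_left: "cinner (x + y) z = cinner x z + cinner y z"
    and cinner_scaleC_left: "cinner (c *\<^sub>C x) y = c * cinner x y"
    and inner_eq_Re_cinner: "x \<bullet> y = Re (cinner x y)"

text \<open>
  A possibly unbounded operator is a partial function whose domain of definition is \<open>dom T\<close>.
  Thus equality of operators includes equality of domains, and \<open>\<circ>\<^sub>m\<close> is the product of operators
  with its natural domain.
\<close>

type_synonym 'h operator = "'h \<rightharpoonup> 'h"

definition linear_operator :: "'h::complex_hilbert_space operator \<Rightarrow> bool" where
  "linear_operator T \<longleftrightarrow> 0 \<in> dom T \<and>
     (\<forall>x\<in>dom T. \<forall>y\<in>dom T. T (x + y) = Some (the (T x) + the (T y))) \<and>
     (\<forall>c. \<forall>x\<in>dom T. T (c *\<^sub>C x) = Some (c *\<^sub>C the (T x)))"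

definition densely_defined :: "'h::complex_hilbert_space operator \<Rightarrow> bool" where
  "densely_defined T \<longleftrightarrow> closure (dom T) = UNIV"

text \<open>For densely defined \<open>T\<close> a vector \<open>z\<close> as below is automatically unique.\<close>

definition op_adjoint :: "'h::complex_hilbert_space operator \<Rightarrow> 'h operator" where
  "op_adjoint T = (\<lambda>y.
     if \<exists>!z. \<forall>x\<in>dom T. cinner (the (T x)) y = cinner x z
     then Some (THE z. \<forall>x\<in>dom T. cinner (the (T x)) y = cinner x z)
     else None)"

definition self_adjoint :: "'h::complex_hilbert_space operator \<Rightarrow> bool" where
  "self_adjoint T \<longleftrightarrow> linear_operator T \<and> densely_defined T \<and> op_adjoint T = T"

definition positive_self_adjoint :: "'h::complex_hilbert_space operator \<Rightarrow> bool" where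
  "positive_self_adjoint T \<longleftrightarrow>
     self_adjoint T \<and> (\<forall>x\<in>dom T. cinner (the (T x)) x \<in> \<real>\<^sub>\<ge>\<^sub>0)"

text \<open>
  The space \<open>L\<^sup>2\<close> is represented by its functions rather than by classes modulo a.e. equality.
  A map that is additive and isometric on these functions identifies a.e. equal ones, so
  \<open>unitary_L2 M W\<close> describes exactly the unitary maps from the quotient onto the Hilbert space,
  and \<open>inv_into (L2 M) W\<close> is the inverse of that map, up to the choice of a representative.
\<close>

definition L2 :: "'w measure \<Rightarrow> ('w \<Rightarrow> complex) set" where
  "L2 M = {f \<in> borel_measurable M. integrable M (\<lambda>\<omega>. (cmod (f \<omega>))\<^sup>2)}"

definition unitary_L2 ::
    "'w measure \<Rightarrow> (('w \<Rightarrow> complex) \<Rightarrow> 'h::complex_hilbert_space) \<Rightarrow> bool" where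
  "unitary_L2 M W \<longleftrightarrow>
     (\<forall>f\<in>L2 M. \<forall>g\<in>L2 M. W (\<lambda>\<omega>. f \<omega> + g \<omega>) = W f + W g) \<and>
     (\<forall>c. \<forall>f\<in>L2 M. W (\<lambda>\<omega>. c * f \<omega>) = c *\<^sub>C W f) \<and>
     (\<forall>f\<in>L2 M. \<forall>g\<in>L2 M. cinner (W f) (W g) = (LINT \<omega>|M. f \<omega> * cnj (g \<omega>))) \<and>
     W ` L2 M = UNIV"

text \<open>The operator \<open>W m W\<^sup>-\<^sup>1\<close>, where \<open>m\<close> acts by multiplication on its maximal domain.\<close>

definition mult_operator ::
    "'w measure \<Rightarrow> (('w \<Rightarrow> complex) \<Rightarrow> 'h::complex_hilbert_space) \<Rightarrow> ('w \<Rightarrow> complex) \<Rightarrow> 'h operator"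
  where
  "mult_operator M W m = (\<lambda>\<phi>.
     let g = (\<lambda>\<omega>. m \<omega> * inv_into (L2 M) W \<phi> \<omega>)
     in if g \<in> L2 M then Some (W g) else None)"

definition spectral_representation ::
    "'h::complex_hilbert_space operator \<Rightarrow> 'w measure \<Rightarrow> ('w \<Rightarrow> real)
      \<Rightarrow> (('w \<Rightarrow> complex) \<Rightarrow> 'h) \<Rightarrow> bool" where
  "spectral_representation A M a W \<longleftrightarrow>
     a \<in> borel_measurable M \<and> (AE \<omega> in M. 0 \<le> a \<omega>) \<and> unitary_L2 M W \<and>
     (\<forall>f\<in>L2 M.
        (W f \<in> dom A \<longleftrightarrow> (\<lambda>\<omega>. complex_of_real (a \<omega>) * f \<omega>) \<in> L2 M) \<and>
        (W f \<in> dom A \<longrightarrow> A (W f) = Some (W (\<lambda>\<omega>. complex_of_real (a \<omega>) * f \<omega>))))"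

definition mittag_leffler :: "real \<Rightarrow> complex \<Rightarrow> complex" where
  "mittag_leffler \<alpha> z = (\<Sum>k. z ^ k / complex_of_real (Gamma (\<alpha> * real k + 1)))"

definition it_powr :: "real \<Rightarrow> real \<Rightarrow> complex" where
  "it_powr t \<alpha> = exp (\<i> * complex_of_real (\<alpha> * pi / 2)) * complex_of_real (t powr \<alpha>)"

definition minus_it_powr :: "real \<Rightarrow> real \<Rightarrow> complex" where
  "minus_it_powr t \<alpha> = exp (- \<i> * complex_of_real (\<alpha> * pi / 2)) * complex_of_real (t powr \<alpha>)"

definition solution_operator ::
    "'w measure \<Rightarrow> ('w \<Rightarrow> real) \<Rightarrow> (('w \<Rightarrow> complex) \<Rightarrow> 'h::complex_hilbert_space)
      \<Rightarrow> real \<Rightarrow> real \<Rightarrow> 'h operator" where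
  "solution_operator M a W \<alpha> t =
     mult_operator M W (\<lambda>\<omega>. mittag_leffler \<alpha> (minus_it_powr t \<alpha> * complex_of_real (a \<omega>)))"

definition unitary_map :: "('h::complex_hilbert_space \<Rightarrow> 'h) \<Rightarrow> bool" where
  "unitary_map V \<longleftrightarrow>
     (\<forall>x y. V (x + y) = V x + V y) \<and> (\<forall>c x. V (c *\<^sub>C x) = c *\<^sub>C V x) \<and>
     (\<forall>x y. cinner (V x) (V y) = cinner x y) \<and> surj V"

definition unitary_group :: "(real \<Rightarrow> 'h::complex_hilbert_space \<Rightarrow> 'h) \<Rightarrow> bool" where
  "unitary_group V \<longleftrightarrow>
     (\<forall>t. unitary_map (V t)) \<and> V 0 = id \<and> (\<forall>s t. V (s + t) = V s \<circ> V t) \<and>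
     (\<forall>\<phi>. continuous_on UNIV (\<lambda>t. V t \<phi>))"

text \<open>
  \<open>V t = exp (- \<i> t A)\<close> in the sense of Stone's theorem: \<open>A \<phi> = \<psi>\<close> (in particular \<open>\<phi> \<in> dom A\<close>)
  holds exactly if \<open>V t \<phi>\<close> is differentiable at \<open>0\<close> with derivative \<open>- \<i> \<psi>\<close>.
\<close>

definition generated_unitary_group ::
    "'h::complex_hilbert_space operator \<Rightarrow> (real \<Rightarrow> 'h \<Rightarrow> 'h) \<Rightarrow> bool" where
  "generated_unitary_group A V \<longleftrightarrow> unitary_group V \<and>
     (\<forall>\<phi> \<psi>. A \<phi> = Some \<psi> \<longleftrightarrow> ((\<lambda>t. V t \<phi>) has_vector_derivative (- \<i>) *\<^sub>C \<psi>) (at 0))"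

end

theory Submission
  imports Defs "HOL-Complex_Analysis.Complex_Analysis" "HOL-Real_Asymp.Real_Asymp"
begin

text \<open>
  Everything reduces to multiplication operators, so the analytic content is the behaviour of
  \<open>E\<^sub>\<alpha>\<close> on the ray \<open>arg z = - \<alpha> \<pi> / 2\<close>. Inserting Hankel's formula for \<open>1 / \<Gamma>\<close> into the power series gives
  \<open>2 \<pi> \<i> E\<^sub>\<alpha> (exp (\<alpha> v)) = \<integral> exp (exp w) / (1 - exp (- \<alpha> (w - v))) dw\<close>, where the variable \<open>\<zeta> = exp w\<close> of the Hankel
  contour has been replaced by its logarithm and the integral is the limit for \<open>R \<longrightarrow> \<infinity>\<close> of integrals
  over the segments from \<open>R - \<pi> \<i>\<close> to \<open>R + \<pi> \<i>\<close>. Moving the contour across the pole \<open>w = v\<close> shows that \<open>E\<^sub>\<alpha>\<close> is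
  bounded on the ray, uniformly for \<open>\<alpha>\<close> close to 1. Since \<open>E\<^sub>\<alpha> ((- \<i> t)\<^sup>\<alpha> a) \<longrightarrow> exp (- \<i> t a)\<close> pointwise,
  dominated convergence gives the limit in \<open>L\<^sup>2\<close>. The limit is the given unitary group: for \<open>\<phi>\<close> in the
  domain of \<open>A\<close> the inner product of the two orbits of \<open>\<phi>\<close> is constant in \<open>t\<close>, hence the orbits coincide.
\<close>

section \<open>Integrals over vertical segments and Hankel's formula\<close>

text \<open>Under \<zeta> = exp w this segment becomes the circle of radius exp R, traversed once
  from the negative axis back to it. Letting R grow replaces the unbounded Hankel contour.\<close>

definition vertical_integral :: "real \<Rightarrow> (complex \<Rightarrow> complex) \<Rightarrow> complex" where
  "vertical_integral R f = contour_integral (linepath (Complex R (- pi)) (Complex R pi)) f"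

lemma vertical_segment:
  "closed_segment (Complex R (- pi)) (Complex R pi) = {w. Re w = R \<and> \<bar>Im w\<bar> \<le> pi}"
  using pi_gt_zero
  by (subst closed_segment_same_Re) (auto simp: closed_segment_eq_real_ivl abs_le_iff simp del: pi_gt_zero)

lemma vertical_integrable:
  assumes "f holomorphic_on S" "{w. Re w = R \<and> \<bar>Im w\<bar> \<le> pi} \<subseteq> S"
  shows "f contour_integrable_on linepath (Complex R (- pi)) (Complex R pi)"
proof (rule contour_integrable_continuous_linepath)
  show "continuous_on (closed_segment (Complex R (- pi)) (Complex R pi)) f"
    unfolding vertical_segment
    using assms holomorphic_on_imp_continuous_on holomorphic_on_subset by blast
qed

lemma vertical_integral_primitive:
  assumes P: "\<And>w. w \<in> S \<Longrightarrow> (P has_field_derivative f w) (at w within S)"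
    and S: "{w. Re w = R \<and> \<bar>Im w\<bar> \<le> pi} \<subseteq> S"
  shows "vertical_integral R f = P (Complex R pi) - P (Complex R (- pi))"
proof -
  have "(f has_contour_integral (P (pathfinish (linepath (Complex R (- pi)) (Complex R pi)))
      - P (pathstart (linepath (Complex R (- pi)) (Complex R pi)))))
      (linepath (Complex R (- pi)) (Complex R pi))"
    by (rule contour_integral_primitive[OF P]) (use S in \<open>auto simp: vertical_segment\<close>)
  then show ?thesis
    unfolding vertical_integral_def by (simp add: contour_integral_unique)
qed

lemma vertical_integral_le:
  assumes hol: "f holomorphic_on S" "{w. Re w = R \<and> \<bar>Im w\<bar> \<le> pi} \<subseteq> S"
    and B: "\<And>w. Re w = R \<Longrightarrow> \<bar>Im w\<bar> \<le> pi \<Longrightarrow> cmod (f w) \<le> B"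
  shows "cmod (vertical_integral R f) \<le> 2 * pi * B"
proof -
  have "0 \<le> B"
    using order.trans[OF norm_ge_zero B[of "Complex R 0"]] by simp
  moreover have "cmod (Complex R pi - Complex R (- pi)) = 2 * pi"
    by (simp add: cmod_def real_sqrt_mult)
  ultimately show ?thesis
    using contour_integral_bound_linepath[OF vertical_integrable[OF hol], of B] B
    unfolding vertical_integral_def by (simp add: vertical_segment mult_ac)
qed

lemma has_vector_derivative_horizontal:
  assumes "(P has_field_derivative D) (at (Complex u y))"
  shows "((\<lambda>u. P (Complex u y)) has_vector_derivative D) (at u)"
proof -
  have "((\<lambda>u. Complex u y) has_vector_derivative 1) (at u)"
    unfolding has_vector_derivative_complex_iff by (auto intro!: derivative_eq_intros)
  from field_vector_diff_chain_at[OF this assms] show ?thesis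
    by (simp add: o_def)
qed

lemma norm_exp_exp: "cmod (exp (exp w)) = exp (exp (Re w) * cos (Im w))"
  by (simp add: Re_exp)

text \<open>
  Cauchy's theorem shifts the segment \<open>Re w = R\<close> to the line \<open>Re w = c\<close> at the price of the two
  horizontal lines \<open>\<bar>Im w\<bar> = pi\<close>, on which \<open>exp (exp w)\<close> decays doubly exponentially.
\<close>

lemma vertical_integral_bound:
  assumes hol: "f holomorphic_on S" and S: "open S" "convex S"
    and sub: "{w. c \<le> Re w \<and> \<bar>Im w\<bar> \<le> pi} \<subseteq> S"
    and c: "0 \<le> c" "c \<le> R"
    and B: "\<And>w. c \<le> Re w \<Longrightarrow> \<bar>Im w\<bar> \<le> pi \<Longrightarrow> Re w = c \<or> \<bar>Im w\<bar> = pi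
              \<Longrightarrow> cmod (f w) \<le> B * cmod (exp (exp w))"
  shows "cmod (vertical_integral R f) \<le> B * (2 * pi * exp (exp c) + 2)"
proof -
  \<comment> \<open>A primitive on the convex set \<open>S\<close> plays the role of Cauchy's
    theorem: each side of the contour contributes the difference of \<open>P\<close> at its
    ends.\<close>
  obtain P where P: "\<And>w. w \<in> S \<Longrightarrow> (P has_field_derivative f w) (at w within S)"
    by (rule holomorphic_convex_primitive'[OF S(2,1) hol]) (rule that, blast)
  have P': "(P has_field_derivative f w) (at w)" if "w \<in> S" for w
    using P[OF that] at_within_open[OF that S(1)] by metis
  have B0: "0 \<le> B"
  proof -
    have "0 \<le> B * cmod (exp (exp (Complex c 0)))"
      by (rule order.trans[OF norm_ge_zero B]) auto
    then show ?thesis by (simp add: zero_le_mult_iff)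
  qed
  have horizontal: "cmod (P (Complex R y) - P (Complex c y)) \<le> B" if y: "\<bar>y\<bar> = pi" for y
  proof (cases "c = R")
    case True
    then show ?thesis using B0 by simp
  next
    case False
    have der: "((\<lambda>u. P (Complex u y)) has_vector_derivative f (Complex u y)) (at u)" if "c \<le> u" for u
    proof (rule has_vector_derivative_horizontal[OF P'])
      show "Complex u y \<in> S" using sub y that by auto
    qed
    \<comment> \<open>On these lines exp (exp w) has modulus exp (- exp u), at most exp (- u). The
      comparison function - B exp (- u) is the antiderivative of B exp (- u).\<close>
    have "cmod (P (Complex R y) - P (Complex c y)) \<le> - B * exp (- R) - (- B * exp (- c))"
    proof (rule differentiable_bound_general[where f' = "\<lambda>u. f (Complex u y)" and \<phi>' = "\<lambda>u. B * exp (- u)"])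
      show "continuous_on {c..R} (\<lambda>u. P (Complex u y))"
        by (intro continuous_at_imp_continuous_on ballI has_vector_derivative_continuous[OF der]) simp
      show "cmod (f (Complex u y)) \<le> B * exp (- u)" if "c < u" for u
      proof -
        have "cos y = - 1"
          using y by (metis cos_abs_real cos_pi)
        moreover have "u \<le> exp u"
          using exp_ge_add_one_self[of u] by linarith
        ultimately have "cmod (exp (exp (Complex u y))) \<le> exp (- u)"
          by (simp add: norm_exp_exp Re_exp)
        then show ?thesis
          using that y B0 by (intro order.trans[OF B mult_left_mono]) auto
      qed
    qed (use False c der in \<open>auto intro!: continuous_intros derivative_eq_intros
           simp: has_real_derivative_iff_has_vector_derivative[symmetric]\<close>)
    also have "\<dots> \<le> B"
    proof -
      have "B * exp (- c) \<le> B" "0 \<le> B * exp (- R)"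
        using B0 c by (simp_all add: mult_left_le)
      then show ?thesis by linarith
    qed
    finally show ?thesis .
  qed
  have vert: "cmod (vertical_integral c f) \<le> 2 * pi * (B * exp (exp c))"
  proof (rule vertical_integral_le[OF hol])
    show "cmod (f w) \<le> B * exp (exp c)" if "Re w = c" "\<bar>Im w\<bar> \<le> pi" for w
    proof -
      have "cmod (exp (exp w)) \<le> exp (exp c)"
        using that by (simp add: norm_exp_exp Re_exp)
      then show ?thesis
        using that B0 by (intro order.trans[OF B mult_left_mono]) auto
    qed
  qed (use sub in auto)
  have eq: "vertical_integral r f = P (Complex r pi) - P (Complex r (- pi))" if "c \<le> r" for r
    using sub that by (intro vertical_integral_primitive[OF P]) auto
  have "vertical_integral R f = vertical_integral c f
      + (P (Complex R pi) - P (Complex c pi)) - (P (Complex R (- pi)) - P (Complex c (- pi)))"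
    using eq[of c] eq[of R] c by simp
  also have "cmod \<dots> \<le> 2 * pi * (B * exp (exp c)) + B + B"
    by (rule order.trans[OF norm_triangle_ineq4 add_mono[OF order.trans[OF norm_triangle_ineq
          add_mono[OF vert horizontal]] horizontal]]) simp_all
  finally show ?thesis by (simp add: algebra_simps)
qed

text \<open>The integral over an unbounded set is a limit over boxes that contain large balls. Among
  them the boxes [-b, b] suffice, and on these the integrand extended by 0 has the integral over
  [0, b].\<close>

lemma tendsto_integral_atLeast:
  fixes g :: "real \<Rightarrow> 'a::banach"
  assumes g: "(g has_integral I) {0..}"
    and T: "\<And>b. b > 0 \<Longrightarrow> (g has_integral T b) {0..b}"
  shows "(T \<longlongrightarrow> I) at_top"
proof (rule tendstoI)
  fix e :: real assume e: "e > 0"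
  \<comment> \<open>The description by large balls, \<open>has_integral_altD\<close>, concerns sets
    that are not boxes.\<close>
  have "{0..} \<noteq> cbox a b" for a b :: real
  proof
    assume "{0..} = cbox a b"
    then have "\<bar>b\<bar> + 1 \<in> cbox a b" by (metis abs_ge_zero add_increasing2 atLeast_iff zero_le_one add.commute)
    then show False by (auto simp: abs_if split: if_splits)
  qed
  then have nbox: "\<not> (\<exists>a b :: real. {0..} = cbox a b)" by blast
  obtain B where B: "B > 0" "\<And>a b. ball 0 B \<subseteq> cbox a b \<Longrightarrow>
      \<exists>z. ((\<lambda>x. if x \<in> {0..} then g x else 0) has_integral z) (cbox a b) \<and> norm (z - I) < e"
    using has_integral_altD[OF g nbox e] by metis
  show "\<forall>\<^sub>F b in at_top. dist (T b) I < e"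
    using eventually_ge_at_top[of B]
  proof eventually_elim
    case (elim b)
    obtain z where z: "((\<lambda>x. if x \<in> {0..} then g x else 0) has_integral z) (cbox (- b) b)"
        "norm (z - I) < e"
    proof -
      have "ball 0 B \<subseteq> cbox (- b) b"
        using elim by (auto simp: dist_real_def)
      from B(2)[OF this] show thesis using that by blast
    qed
    have "((\<lambda>x. if x \<in> {0..b} then g x else 0) has_integral T b) (cbox (- b) b)"
      by (subst has_integral_restrict) (use T[of b] elim B(1) in auto)
    then have "((\<lambda>x. if x \<in> {0..} then g x else 0) has_integral T b) (cbox (- b) b)"
      by (rule has_integral_eq[rotated]) auto
    then have "z = T b" using z(1) has_integral_unique by blast
    then show ?case using z(2) by (simp add: dist_norm)
  qed
qed

lemma vertical_integral_lincomb:
  assumes f: "f holomorphic_on S" and g: "g holomorphic_on S"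
    and S: "{w. Re w = R \<and> \<bar>Im w\<bar> \<le> pi} \<subseteq> S"
  shows "vertical_integral R (\<lambda>w. f w - c * g w) = vertical_integral R f - c * vertical_integral R g"
  unfolding vertical_integral_def
  by (subst contour_integral_diff)
    (auto intro: vertical_integrable[OF f S] vertical_integrable[OF g S] contour_integrable_lmul
      simp: contour_integral_lmul vertical_integrable[OF g S])

section \<open>The kernel of Hankel's formula and the reciprocal Gamma function\<close>

text \<open>With \<zeta> = exp w this is Hankel's integrand exp \<zeta> * \<zeta> powr (- s - 1)
  d\<zeta>; the factor exp w of d\<zeta> changes the exponent to - s. In the variable w the
  integrand is entire and has no branch cut.\<close>

definition hankel_kernel :: "real \<Rightarrow> complex \<Rightarrow> complex" where
  "hankel_kernel s w = exp (exp w - complex_of_real s * w)"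

lemma holomorphic_hankel_kernel [holomorphic_intros]: "hankel_kernel s holomorphic_on S"
  unfolding hankel_kernel_def by (intro holomorphic_intros)

lemma norm_hankel_kernel:
  "cmod (hankel_kernel s w) = exp (exp (Re w) * cos (Im w) - s * Re w)"
  by (simp add: hankel_kernel_def Re_exp)

text \<open>The two values differ only in phase, so their difference, the jump across the cut of the
  power, is a real function of u times a constant multiple of sin (\<pi> s).\<close>

lemma hankel_kernel_horizontal:
  "hankel_kernel s (Complex u pi) = of_real (exp (- exp u - s * u)) * exp (- \<i> * of_real (pi * s))"
  "hankel_kernel s (Complex u (- pi)) = of_real (exp (- exp u - s * u)) * exp (\<i> * of_real (pi * s))"
proof -
  have "exp (Complex u pi) - of_real s * Complex u pi
      = of_real (- exp u - s * u) + (- \<i> * of_real (pi * s))"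
    "exp (Complex u (- pi)) - of_real s * Complex u (- pi)
      = of_real (- exp u - s * u) + (\<i> * of_real (pi * s))"
    by (simp_all add: complex_eq_iff Re_exp Im_exp)
  then show
    "hankel_kernel s (Complex u pi) = of_real (exp (- exp u - s * u)) * exp (- \<i> * of_real (pi * s))"
    "hankel_kernel s (Complex u (- pi)) = of_real (exp (- exp u - s * u)) * exp (\<i> * of_real (pi * s))"
    by (simp_all only: hankel_kernel_def exp_add exp_of_real)
qed

text \<open>For these s the integral vanishes as R tends to minus infinity. As a function of v = exp
  R it is therefore the integral over (0, v) of its derivative, which comes from the jump of the
  kernel between the two horizontal lines. In the limit this is Euler's integral for Gamma (-
  s).\<close>

lemma hankel_negative:
  assumes s: "- 1 < s" "s < 0"
  shows "((\<lambda>R. vertical_integral R (hankel_kernel s)) \<longlongrightarrow> 2 * of_real pi * \<i> / of_real (Gamma (s + 1))) at_top"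
proof -
  obtain P where P: "\<And>w. (P has_field_derivative hankel_kernel s w) (at w)"
    by (rule holomorphic_convex_primitive'[of UNIV "hankel_kernel s"])
      (auto intro: holomorphic_intros)
  \<comment> \<open>The difference of the two phases exp (- i \<pi> s) and exp (i \<pi> s).\<close>
  define C where "C = - 2 * \<i> * of_real (sin (pi * s))"
  define g where "g v = C * of_real (v powr (- s - 1) / exp v)" for v :: real
  \<comment> \<open>The value 0 at v = 0 is the limit from the right. It makes \<open>Q\<close>
    continuous on [0, b], so that the fundamental theorem applies with
    \<open>Q 0 = 0\<close>.\<close>
  define Q where "Q v = (if v \<le> 0 then 0 else vertical_integral (ln v) (hankel_kernel s))" for v
  have Q_eq: "Q v = P (Complex (ln v) pi) - P (Complex (ln v) (- pi))" if "v > 0" for v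
    unfolding Q_def using that vertical_integral_primitive[of UNIV P "hankel_kernel s", OF P] by simp
  have der: "(Q has_vector_derivative g v) (at v)" if v: "v > 0" for v
  proof -
    have "((\<lambda>u. P (Complex u pi) - P (Complex u (- pi))) has_vector_derivative
        (hankel_kernel s (Complex (ln v) pi) - hankel_kernel s (Complex (ln v) (- pi)))) (at (ln v))"
      by (intro has_vector_derivative_diff has_vector_derivative_horizontal P)
    moreover have "(ln has_vector_derivative 1 / v) (at v)"
      using v by (auto intro!: derivative_eq_intros simp: has_real_derivative_iff_has_vector_derivative[symmetric])
    ultimately have "((\<lambda>u. P (Complex (ln u) pi) - P (Complex (ln u) (- pi))) has_vector_derivative
        (1 / v) *\<^sub>R (hankel_kernel s (Complex (ln v) pi) - hankel_kernel s (Complex (ln v) (- pi)))) (at v)"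
      using vector_diff_chain_at[of ln "1 / v" v] by (simp add: o_def)
    moreover have "(1 / v) *\<^sub>R (hankel_kernel s (Complex (ln v) pi) - hankel_kernel s (Complex (ln v) (- pi))) = g v"
    proof -
      have "exp (- \<i> * of_real (pi * s)) - exp (\<i> * of_real (pi * s)) = C"
        unfolding C_def by (simp add: complex_eq_iff Re_exp Im_exp)
      moreover have "v powr (- s - 1) / exp v = exp (- exp (ln v) - s * ln v) / v"
        using v by (simp add: powr_def exp_diff exp_minus field_simps)
      ultimately show ?thesis
        unfolding g_def hankel_kernel_horizontal right_diff_distrib[symmetric]
        by (simp add: scaleR_conv_of_real field_simps)
    qed
    ultimately show ?thesis
      using has_vector_derivative_transform_within_open[of _ "g v" v "{0<..}" Q] v Q_eq by simp
  qed
  \<comment> \<open>For Re w = ln v with v < 1 the kernel is at most exp 1 * v powr (- s), which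
    tends to 0 with v because s < 0.\<close>
  have lim0: "(Q \<longlongrightarrow> 0) (at_right 0)"
  proof (rule Lim_null_comparison)
    show "\<forall>\<^sub>F v in at_right 0. cmod (Q v) \<le> 2 * pi * (exp 1 * v powr (- s))"
      unfolding eventually_at_right_field
    proof (intro exI[of _ 1] conjI allI impI)
      fix v :: real assume v: "v > 0" "v < 1"
      have "cmod (vertical_integral (ln v) (hankel_kernel s)) \<le> 2 * pi * (exp 1 * v powr (- s))"
      proof (intro vertical_integral_le[of _ UNIV])
        fix w assume "Re w = ln v"
        then have "exp (Re w) * cos (Im w) \<le> 1"
          using v mult_left_le[of "cos (Im w)" v] cos_le_one[of "Im w"] by (simp add: order.trans[OF mult_left_le])
        then show "cmod (hankel_kernel s w) \<le> exp 1 * v powr (- s)"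
          using v \<open>Re w = ln v\<close> by (simp add: norm_hankel_kernel powr_def flip: exp_add)
      qed (auto intro: holomorphic_intros)
      then show "cmod (Q v) \<le> 2 * pi * (exp 1 * v powr (- s))"
        using v by (simp add: Q_def)
    qed simp
    have "((\<lambda>v. 2 * pi * (exp 1 * v powr (- s))) \<longlongrightarrow> 2 * pi * (exp 1 * 0)) (at_right 0)"
      using s by (intro tendsto_intros) real_asymp
    then show "((\<lambda>v. 2 * pi * (exp 1 * v powr (- s))) \<longlongrightarrow> 0) (at_right 0)"
      by simp
  qed
  have "(Q \<longlongrightarrow> of_real (Gamma (- s)) * C) at_top"
  proof (rule tendsto_integral_atLeast)
    have "((\<lambda>v. of_real (v powr (- s - 1) / exp v) * C) has_integral of_real (Gamma (- s)) * C) {0..}"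
      using has_integral_linear[OF Gamma_integral_real[of "- s"], of "\<lambda>x. of_real x * C"] s
      by (simp add: o_def bounded_linear_mult_const bounded_linear_of_real)
    then show "(g has_integral of_real (Gamma (- s)) * C) {0..}"
      unfolding g_def by (simp add: mult.commute)
    show "(g has_integral Q b) {0..b}" if "b > 0" for b
    proof -
      have "continuous_on {0..b} Q"
        unfolding continuous_on_eq_continuous_within
      proof
        fix v assume "v \<in> {0..b}"
        show "continuous (at v within {0..b}) Q"
        proof (cases "v = 0")
          case True
          have "(Q \<longlongrightarrow> 0) (at 0 within {0..b})"
            using lim0 that by (simp add: at_within_Icc_at_right)
          then show ?thesis using True by (simp add: continuous_within Q_def)
        next
          case False
          then show ?thesis
            using \<open>v \<in> {0..b}\<close> der[of v] has_vector_derivative_continuous continuous_at_imp_continuous_at_within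
            by (metis atLeastAtMost_iff less_eq_real_def)
        qed
      qed
      then have "(g has_integral Q b - Q 0) {0..b}"
        using that der by (intro fundamental_theorem_of_calculus_interior) auto
      then show ?thesis by (simp add: Q_def)
    qed
  qed
  then have "((\<lambda>R. Q (exp R)) \<longlongrightarrow> of_real (Gamma (- s)) * C) at_top"
    by (rule filterlim_compose) (rule exp_at_top)
  \<comment> \<open>The reflection formula at - s; its sine cancels the one in
    \<open>C\<close>.\<close>
  moreover have "of_real (Gamma (- s)) * C = 2 * of_real pi * \<i> / of_real (Gamma (s + 1))"
  proof -
    have "Gamma (- s) * Gamma (1 + s) = - (pi / sin (pi * s))"
    proof -
      have "1 - complex_of_real (- s) = of_real (1 + s)"
        "of_real pi * complex_of_real (- s) = of_real (- (pi * s))"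
        by simp_all
      with Gamma_reflection_complex[of "of_real (- s)"]
      have "complex_of_real (Gamma (- s) * Gamma (1 + s)) = of_real (pi / sin (- (pi * s)))"
        by (simp only: Gamma_complex_of_real sin_of_real of_real_mult of_real_divide)
      then have "Gamma (- s) * Gamma (1 + s) = pi / sin (- (pi * s))"
        by (simp only: of_real_eq_iff)
      then show ?thesis by simp
    qed
    moreover have "sin (pi * s) \<noteq> 0"
    proof -
      have "0 < - (pi * s)" "- (pi * s) < pi"
        using s mult_strict_left_mono[of "- s" 1 pi] by (simp_all add: mult_less_0_iff)
      then show ?thesis using sin_gt_zero[of "- (pi * s)"] by simp
    qed
    ultimately
    have "Gamma (- s) * sin (pi * s) = - pi / Gamma (s + 1)"
    proof -
      have "Gamma (s + 1) \<noteq> 0"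
        using Gamma_real_pos[of "s + 1"] s by linarith
      moreover have "Gamma (- s) * sin (pi * s) * Gamma (s + 1) = - pi"
        using \<open>Gamma (- s) * Gamma (1 + s) = _\<close> \<open>sin (pi * s) \<noteq> 0\<close> by (simp add: field_simps)
      ultimately show ?thesis
        by (subst nonzero_eq_divide_eq)
    qed
    then have "complex_of_real (Gamma (- s) * sin (pi * s)) = of_real (- pi / Gamma (s + 1))"
      by (rule arg_cong)
    then show ?thesis
      unfolding C_def by (simp add: field_simps)
  qed
  ultimately show ?thesis by (simp add: Q_def)
qed

text \<open>With the entire function F z = (exp z - 1) / z and a primitive h of it, the kernel has
  the primitive w + h (exp w). The second summand is periodic, so only w contributes.\<close>

lemma hankel_zero: "vertical_integral R (hankel_kernel 0) = 2 * pi * \<i>"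
proof -
  define F where "F z = (if z = 0 then deriv exp 0 else (exp z - exp 0) / (z - 0))" for z :: complex
  have "F holomorphic_on UNIV"
    unfolding F_def by (rule pole_lemma) (auto intro: holomorphic_intros)
  then obtain h where h: "\<And>w. (h has_field_derivative F w) (at w)"
    using holomorphic_convex_primitive'[of UNIV F] by auto
  have "vertical_integral R (hankel_kernel 0)
      = (Complex R pi + h (exp (Complex R pi))) - (Complex R (- pi) + h (exp (Complex R (- pi))))"
  proof (rule vertical_integral_primitive[of UNIV])
    fix w
    have "((\<lambda>w. w + h (exp w)) has_field_derivative 1 + F (exp w) * exp w) (at w)"
      by (auto intro!: derivative_eq_intros DERIV_chain2[OF h])
    then show "((\<lambda>w. w + h (exp w)) has_field_derivative hankel_kernel 0 w) (at w within UNIV)"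
      by (simp add: F_def hankel_kernel_def)
  qed simp
  moreover have "exp (Complex R pi) = exp (Complex R (- pi))"
    by (simp add: complex_eq_iff Re_exp Im_exp)
  ultimately show ?thesis by (simp add: complex_eq_iff)
qed

text \<open>Integration by parts: the derivative of \<open>hankel_kernel (s + 1)\<close> is
  \<open>hankel_kernel s\<close> minus s + 1 times itself, and its values at the ends of the segment
  tend to 0. This mirrors the functional equation of Gamma.\<close>

lemma hankel_step:
  assumes s: "s > - 1"
    and lim: "((\<lambda>R. vertical_integral R (hankel_kernel s)) \<longlongrightarrow> 2 * of_real pi * \<i> / of_real (Gamma (s + 1))) at_top"
  shows "((\<lambda>R. vertical_integral R (hankel_kernel (s + 1))) \<longlongrightarrow> 2 * of_real pi * \<i> / of_real (Gamma (s + 1 + 1))) at_top"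
proof -
  define E where "E w = hankel_kernel (s + 1) w" for w
  have E: "vertical_integral R (hankel_kernel s) - (s + 1) * vertical_integral R (hankel_kernel (s + 1))
      = E (Complex R pi) - E (Complex R (- pi))" for R
  proof -
    have "vertical_integral R (\<lambda>w. hankel_kernel s w - complex_of_real (s + 1) * hankel_kernel (s + 1) w)
        = E (Complex R pi) - E (Complex R (- pi))"
    proof (rule vertical_integral_primitive[of UNIV])
      fix w
      have "exp w * E w = hankel_kernel s w"
        unfolding E_def hankel_kernel_def exp_add[symmetric] by (simp add: algebra_simps)
      then show "(E has_field_derivative hankel_kernel s w - complex_of_real (s + 1) * hankel_kernel (s + 1) w)
          (at w within UNIV)"
        unfolding E_def hankel_kernel_def[abs_def]
        by (auto intro!: derivative_eq_intros simp: algebra_simps)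
    qed simp
    then show ?thesis
      by (subst (asm) vertical_integral_lincomb[of _ UNIV]) (auto intro: holomorphic_intros)
  qed
  have E0: "((\<lambda>R. E (Complex R y)) \<longlongrightarrow> 0) at_top" if "\<bar>y\<bar> = pi" for y
  proof (rule Lim_null_comparison)
    have "cos y = - 1"
      using that by (metis cos_abs_real cos_pi)
    then show "\<forall>\<^sub>F R in at_top. cmod (E (Complex R y)) \<le> exp (- exp R - (s + 1) * R)"
      by (simp add: E_def norm_hankel_kernel)
    show "((\<lambda>R. exp (- exp R - (s + 1) * R)) \<longlongrightarrow> 0) at_top"
      using s by real_asymp
  qed
  have ne: "complex_of_real (s + 1) \<noteq> 0"
    using s by (simp only: of_real_eq_0_iff)
  have "((\<lambda>R. (vertical_integral R (hankel_kernel s) - (E (Complex R pi) - E (Complex R (- pi)))) / (s + 1))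
      \<longlongrightarrow> (2 * of_real pi * \<i> / of_real (Gamma (s + 1)) - (0 - 0)) / complex_of_real (s + 1)) at_top"
    by (rule tendsto_divide[OF tendsto_diff[OF lim tendsto_diff[OF E0 E0]] tendsto_const ne]) simp_all
  moreover have "(vertical_integral R (hankel_kernel s) - (E (Complex R pi) - E (Complex R (- pi)))) / (s + 1)
      = vertical_integral R (hankel_kernel (s + 1))" for R
    unfolding E[of R, symmetric] using ne by (simp add: field_simps)
  moreover have "Gamma (s + 1 + 1) = (s + 1) * Gamma (s + 1)"
    using s nonpos_Ints_nonpos[of "s + 1"] by (intro Gamma_plus1) linarith
  ultimately show ?thesis by (simp add: mult.commute)
qed

text \<open>Hankel's formula for \<open>1/\<Gamma>\<close>, with the Hankel contour mapped to a strip by the logarithm.\<close>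

lemma hankel:
  assumes "0 \<le> s"
  shows "((\<lambda>R. vertical_integral R (hankel_kernel s)) \<longlongrightarrow> 2 * of_real pi * \<i> / of_real (Gamma (s + 1))) at_top"
proof -
  have *: "((\<lambda>R. vertical_integral R (hankel_kernel (r + real n))) \<longlongrightarrow> 2 * of_real pi * \<i> / of_real (Gamma (r + real n + 1))) at_top"
    if r: "- 1 < r" "r \<le> 0" for r n
  proof (induction n)
    case 0
    show ?case
      using hankel_negative[of r] hankel_zero r by (cases "r = 0") (auto simp:)
  next
    case (Suc n)
    show ?case
      using hankel_step[OF _ Suc.IH] r by (simp add: algebra_simps)
  qed
  \<comment> \<open>The starting point \<open>s - \<lceil>s\<rceil>\<close> lies in (-1, 0], and
    \<open>nat \<lceil>s\<rceil>\<close> steps lead from it to s.\<close>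
  show ?thesis
    using *[of "s - \<lceil>s\<rceil>" "nat \<lceil>s\<rceil>"] assms by simp linarith
qed

text \<open>Moving the contour to Re w = c gains the factor exp (- s c). The free parameter c can be
  taken large enough to beat the powers of z in the series.\<close>

lemma inverse_Gamma_bound:
  fixes s c :: real
  assumes s: "0 \<le> s" and c: "0 \<le> c"
  shows "1 / Gamma (s + 1) \<le> (exp (exp c) + 1) * exp (- s * c)"
proof -
  have "cmod (2 * of_real pi * \<i> / complex_of_real (Gamma (s + 1))) \<le> exp (- s * c) * (2 * pi * exp (exp c) + 2)"
  proof (rule tendsto_upperbound[OF tendsto_norm[OF hankel[OF s]]])
    show "\<forall>\<^sub>F R in at_top. cmod (vertical_integral R (hankel_kernel s)) \<le> exp (- s * c) * (2 * pi * exp (exp c) + 2)"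
      using eventually_ge_at_top[of c]
    proof eventually_elim
      case (elim R)
      show ?case
      proof (rule vertical_integral_bound[of _ UNIV])
        fix w assume "c \<le> Re w"
        then show "cmod (hankel_kernel s w) \<le> exp (- s * c) * cmod (exp (exp w))"
          using s by (simp add: norm_hankel_kernel norm_exp_exp Re_exp mult_left_mono flip: exp_add)
      qed (use c elim in \<open>auto intro: holomorphic_intros\<close>)
    qed
  qed simp
  also have "\<dots> \<le> exp (- s * c) * (2 * pi * (exp (exp c) + 1))"
    using pi_ge_two by (simp add: algebra_simps)
  finally have "2 * pi * (1 / Gamma (s + 1)) \<le> 2 * pi * ((exp (exp c) + 1) * exp (- s * c))"
    using Gamma_real_pos[of "s + 1"] s by (simp add: norm_divide norm_mult algebra_simps)
  then show ?thesis
    by (rule mult_left_le_imp_le) simp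
qed

section \<open>The Mittag-Leffler function on the critical ray\<close>

lemma mittag_leffler_term_bound:
  assumes "0 < \<alpha>" "0 \<le> c"
  shows "cmod (z ^ k / complex_of_real (Gamma (\<alpha> * real k + 1)))
    \<le> (exp (exp c) + 1) * (cmod z * exp (- \<alpha> * c)) ^ k"
proof -
  have "cmod z ^ k * (1 / Gamma (\<alpha> * real k + 1))
      \<le> cmod z ^ k * ((exp (exp c) + 1) * exp (- (\<alpha> * real k) * c))"
    using assms by (intro mult_left_mono inverse_Gamma_bound) auto
  moreover have "exp (- (\<alpha> * real k) * c) = exp (- \<alpha> * c) ^ k"
    by (simp flip: exp_of_nat_mult add: mult_ac)
  moreover have "Gamma (\<alpha> * real k + 1) > 0"
    using assms by (intro Gamma_real_pos) (simp add: add_nonneg_pos)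
  ultimately show ?thesis
    by (simp add: norm_divide norm_power power_mult_distrib mult_ac)
qed

lemma mittag_leffler_sums:
  assumes "0 < \<alpha>"
  shows "(\<lambda>k. z ^ k / complex_of_real (Gamma (\<alpha> * real k + 1))) sums mittag_leffler \<alpha> z"
  unfolding mittag_leffler_def
proof (rule summable_sums, rule summable_comparison_test')
  \<comment> \<open>Chosen so that the ratio of the majorizing geometric series is cmod z / (1 +
    cmod z).\<close>
  define c where "c = ln (1 + cmod z) / \<alpha>"
  have "exp (- \<alpha> * c) = 1 / (1 + cmod z)"
    using assms by (simp add: c_def exp_minus add_pos_nonneg field_simps)
  then have "cmod z * exp (- \<alpha> * c) < 1"
    by (simp add: add_pos_nonneg divide_less_eq)
  then show "summable (\<lambda>k. (exp (exp c) + 1) * (cmod z * exp (- \<alpha> * c)) ^ k)"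
    by (intro summable_mult summable_geometric) simp
  show "cmod (z ^ k / complex_of_real (Gamma (\<alpha> * real k + 1)))
      \<le> (exp (exp c) + 1) * (cmod z * exp (- \<alpha> * c)) ^ k" for k
    using assms by (intro mittag_leffler_term_bound) (simp_all add: c_def)
qed

lemma continuous_on_mittag_leffler:
  assumes "0 < \<alpha>"
  shows "continuous_on UNIV (mittag_leffler \<alpha>)"
proof (intro continuous_at_imp_continuous_on ballI)
  fix z :: complex
  define K where "K = complex_of_real (cmod z + 1)"
  have "isCont (\<lambda>z. \<Sum>k. (1 / complex_of_real (Gamma (\<alpha> * real k + 1))) * z ^ k) z"
  proof (rule isCont_powser)
    show "summable (\<lambda>k. 1 / complex_of_real (Gamma (\<alpha> * real k + 1)) * K ^ k)"
      using sums_summable[OF mittag_leffler_sums[OF assms, of K]] by simp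
    show "cmod z < cmod K"
      unfolding K_def norm_of_real by simp
  qed
  then show "isCont (mittag_leffler \<alpha>) z"
    by (simp add: mittag_leffler_def[abs_def])
qed

text \<open>The coefficients of the series are real.\<close>

lemma mittag_leffler_cnj:
  assumes "0 < \<alpha>"
  shows "mittag_leffler \<alpha> (cnj z) = cnj (mittag_leffler \<alpha> z)"
proof -
  have "(\<lambda>k. cnj (z ^ k / complex_of_real (Gamma (\<alpha> * real k + 1)))) sums cnj (mittag_leffler \<alpha> z)"
    unfolding sums_cnj by (rule mittag_leffler_sums[OF assms])
  then show ?thesis
    using mittag_leffler_sums[OF assms, of "cnj z"] by (simp add: sums_unique2)
qed

lemma mittag_leffler_0: "0 < \<alpha> \<Longrightarrow> mittag_leffler \<alpha> 0 = 1"
  using sums_unique[OF powser_sums_zero[of "\<lambda>k. 1 / complex_of_real (Gamma (\<alpha> * real k + 1))"]]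
  by (simp add: mittag_leffler_def)

lemma mittag_leffler_1: "mittag_leffler 1 z = exp z"
proof -
  have "Gamma (real k + 1) = fact k" for k
    using Gamma_fact[of k] by (simp add: add.commute)
  then show ?thesis
    unfolding mittag_leffler_def exp_def by (simp add: scaleR_conv_of_real divide_inverse mult.commute)
qed

text \<open>Tannery's theorem: the terms converge one by one and are dominated by a geometric series
  that does not depend on \<alpha>.\<close>

lemma tendsto_mittag_leffler_1:
  assumes \<zeta>: "(\<zeta> \<longlongrightarrow> z) (at_left 1)"
  shows "((\<lambda>\<alpha>. mittag_leffler \<alpha> (\<zeta> \<alpha>)) \<longlongrightarrow> exp z) (at_left 1)"
proof -
  \<comment> \<open>Near \<alpha> = 1 the arguments stay below \<open>r\<close> in modulus and
    \<alpha> exceeds 1/2. The choice of \<open>c\<close> then bounds the ratio of the dominating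
    series by r / (1 + r).\<close>
  define r where "r = cmod z + 1"
  define c where "c = 2 * ln (1 + r)"
  have r: "r > 0"
    by (simp add: r_def add_nonneg_pos)
  have c: "0 \<le> c" and "exp (- c / 2) = 1 / (1 + r)"
    using r by (simp_all add: c_def exp_minus field_simps)
  then have rc: "r * exp (- c / 2) < 1"
    using r by simp
  have "((\<lambda>\<alpha>. mittag_leffler \<alpha> (\<zeta> \<alpha>)) \<longlongrightarrow> mittag_leffler 1 z) (at_left 1)"
    unfolding mittag_leffler_def
  proof (rule tannerys_theorem[THEN conjunct2, THEN conjunct2])
    show "((\<lambda>\<alpha>. \<zeta> \<alpha> ^ k / complex_of_real (Gamma (\<alpha> * real k + 1)))
        \<longlongrightarrow> z ^ k / complex_of_real (Gamma (1 * real k + 1))) (at_left 1)" for k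
      using nonpos_Ints_nonpos[of "1 * real k + 1"]
      by (intro tendsto_intros \<zeta>) (auto simp: Gamma_eq_zero_iff)
    show "\<forall>\<^sub>F (k, \<alpha>) in at_top \<times>\<^sub>F at_left 1.
        cmod (\<zeta> \<alpha> ^ k / complex_of_real (Gamma (\<alpha> * real k + 1)))
          \<le> (exp (exp c) + 1) * (r * exp (- c / 2)) ^ k"
    proof -
      have "\<forall>\<^sub>F \<alpha> in at_left 1. cmod (\<zeta> \<alpha>) < r"
        using tendsto_norm[OF \<zeta>] by (rule order_tendstoD) (simp add: r_def)
      moreover have "\<forall>\<^sub>F \<alpha> in at_left (1 :: real). 1 / 2 < \<alpha>"
        by (rule eventually_at_leftI[of "1/2"]) auto
      ultimately have "\<forall>\<^sub>F \<alpha> in at_left 1. cmod (\<zeta> \<alpha>) < r \<and> 1 / 2 < \<alpha>"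
        by (rule eventually_conj)
      from eventually_prodI[OF always_eventually[of "\<lambda>_. True"] this]
      show ?thesis
      proof (rule eventually_mono)
        fix p :: "nat \<times> real"
        assume p: "True \<and> cmod (\<zeta> (snd p)) < r \<and> 1 / 2 < snd p"
        obtain k \<alpha> where [simp]: "p = (k, \<alpha>)" by (cases p)
        have "(cmod (\<zeta> \<alpha>) * exp (- \<alpha> * c)) ^ k \<le> (r * exp (- c / 2)) ^ k"
          using p c r mult_right_mono[of "1 / 2" \<alpha> c]
          by (intro power_mono mult_mono) auto
        then have "(exp (exp c) + 1) * (cmod (\<zeta> \<alpha>) * exp (- \<alpha> * c)) ^ k
            \<le> (exp (exp c) + 1) * (r * exp (- c / 2)) ^ k"
          by (rule mult_left_mono) (simp add: add_nonneg_nonneg)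
        with mittag_leffler_term_bound[of \<alpha> c "\<zeta> \<alpha>" k] p c
        show "case p of (k, \<alpha>) \<Rightarrow> cmod (\<zeta> \<alpha> ^ k / complex_of_real (Gamma (\<alpha> * real k + 1)))
          \<le> (exp (exp c) + 1) * (r * exp (- c / 2)) ^ k"
          by simp
      qed simp
    qed
    show "summable (\<lambda>k. (exp (exp c) + 1) * (r * exp (- c / 2)) ^ k)"
      using rc r by (intro summable_mult summable_geometric) simp
  qed simp
  then show ?thesis by (simp add: mittag_leffler_1)
qed

section \<open>The contour integral for the Mittag-Leffler function\<close>

text \<open>For \<alpha> > 0 and Re v < Re w this is the geometric series with terms
  \<open>exp (\<alpha> * v) ^ k * hankel_kernel (\<alpha> * k) w\<close>. Writing the argument of
  the Mittag-Leffler function as exp (\<alpha> v) places a pole at w = v.\<close>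

definition mittag_leffler_kernel :: "real \<Rightarrow> complex \<Rightarrow> complex \<Rightarrow> complex" where
  "mittag_leffler_kernel \<alpha> v w = exp (exp w) / (1 - exp (- of_real \<alpha> * (w - v)))"

text \<open>Termwise, Hankel's formula turns the geometric series into the Mittag-Leffler series.
  The limits in n and R may be exchanged because the remainder is of order \<rho> ^ n uniformly in
  R.\<close>

lemma mittag_leffler_contour:
  assumes \<alpha>: "0 < \<alpha>"
  shows "((\<lambda>R. vertical_integral R (mittag_leffler_kernel \<alpha> v))
    \<longlongrightarrow> 2 * of_real pi * \<i> * mittag_leffler \<alpha> (exp (of_real \<alpha> * v))) at_top"
proof -
  define z where "z = exp (of_real \<alpha> * v)"
  define q where "q w = exp (- of_real \<alpha> * (w - v))" for w
  \<comment> \<open>At least 1 to the right of the pole, so that \<open>q\<close> stays below \<rho>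
    < 1, and nonnegative as \<open>vertical_integral_bound\<close> requires.\<close>
  define c where "c = max 0 (Re v + 1)"
  define \<rho> where "\<rho> = exp (- \<alpha> * (c - Re v))"
  define S where "S = {w. Re v < Re w}"
  \<comment> \<open>What is left of the geometric series after n terms.\<close>
  define rem where "rem n w = q w ^ n * mittag_leffler_kernel \<alpha> v w" for n w
  define V where "V k R = vertical_integral R (hankel_kernel (\<alpha> * real k))" for k R
  have c: "0 \<le> c" "Re v < c" by (auto simp: c_def)
  have S: "open S" "convex S"
    unfolding S_def by (auto simp: open_halfspace_Re_gt convex_halfspace_Re_gt)
  have norm_q: "cmod (q w) = exp (- \<alpha> * (Re w - Re v))" for w
    by (simp add: q_def)
  have q_ne: "1 - q w \<noteq> 0" if "w \<in> S" for w
  proof -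
    have "cmod (q w) < 1"
      using that \<alpha> by (simp add: norm_q S_def mult_pos_pos)
    then show ?thesis by auto
  qed
  have \<rho>: "0 < \<rho>" "\<rho> < 1"
    using \<alpha> c by (auto simp: \<rho>_def)
  have kernel: "mittag_leffler_kernel \<alpha> v w = exp (exp w) / (1 - q w)" for w
    by (simp add: mittag_leffler_kernel_def q_def)
  have q_le: "cmod (q w) \<le> \<rho>" if "c \<le> Re w" for w
    using \<alpha> that by (simp add: norm_q \<rho>_def)
  have q_power: "q w ^ k * exp (exp w) = z ^ k * hankel_kernel (\<alpha> * real k) w" for k w
    unfolding q_def z_def hankel_kernel_def
    by (simp flip: exp_of_nat_mult exp_add add: algebra_simps)
  have hol_q: "q holomorphic_on A" for A
    unfolding q_def by (intro holomorphic_intros)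
  have hol: "rem n holomorphic_on S" for n
    unfolding rem_def kernel
    by (intro holomorphic_intros hol_q) (use q_ne in auto)
  have step: "vertical_integral R (rem (Suc n)) = vertical_integral R (rem n) - z ^ n * V n R"
    if "c \<le> R" for n R
  proof -
    have "vertical_integral R (rem (Suc n))
        = vertical_integral R (\<lambda>w. rem n w - z ^ n * hankel_kernel (\<alpha> * real n) w)"
      unfolding vertical_integral_def
    proof (rule contour_integral_eq)
      fix w assume "w \<in> path_image (linepath (Complex R (- pi)) (Complex R pi))"
      then have "w \<in> S"
        using c that by (auto simp: vertical_segment S_def)
      then show "rem (Suc n) w = rem n w - z ^ n * hankel_kernel (\<alpha> * real n) w"
        using q_ne[of w] unfolding q_power[symmetric]
        by (simp add: rem_def kernel field_simps)
    qed
    also have "\<dots> = vertical_integral R (rem n) - z ^ n * V n R"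
      unfolding V_def using c that
      by (intro vertical_integral_lincomb[of _ S] hol holomorphic_hankel_kernel) (auto simp: S_def)
    finally show ?thesis .
  qed
  have partial: "vertical_integral R (mittag_leffler_kernel \<alpha> v) - (\<Sum>k<n. z ^ k * V k R)
      = vertical_integral R (rem n)" if "c \<le> R" for n R
  proof (induction n)
    case 0
    show ?case by (simp add: rem_def)
  next
    case (Suc n)
    then show ?case using step[OF that, of n] by (simp add: algebra_simps)
  qed
  define C where "C = 2 * pi * exp (exp c) + 2"
  have bound: "cmod (vertical_integral R (rem n)) \<le> \<rho> ^ n / (1 - \<rho>) * C" if "c \<le> R" for n R
    unfolding C_def
  proof (rule vertical_integral_bound[OF hol S])
    fix w assume w: "c \<le> Re w"
    have "1 - \<rho> \<le> cmod (1 - q w)"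
      using norm_triangle_ineq2[of 1 "q w"] q_le[OF w] by simp
    then have "cmod (q w) ^ n / cmod (1 - q w) \<le> \<rho> ^ n / (1 - \<rho>)"
      using \<rho> q_le[OF w] by (intro frac_le power_mono) auto
    then have "cmod (q w) ^ n / cmod (1 - q w) * cmod (exp (exp w)) \<le> \<rho> ^ n / (1 - \<rho>) * cmod (exp (exp w))"
      by (rule mult_right_mono) simp
    then show "cmod (rem n w) \<le> \<rho> ^ n / (1 - \<rho>) * cmod (exp (exp w))"
      by (simp add: rem_def kernel norm_mult norm_divide norm_power)
  qed (use c that in \<open>auto simp: S_def\<close>)
  show ?thesis
    unfolding z_def[symmetric]
  \<comment> \<open>The partial sums converge uniformly for R \<ge> c, and for fixed n the limit in
    R is given by \<open>hankel\<close>.\<close>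
  proof (rule swap_uniform_limit')
    show "\<forall>\<^sub>F n in sequentially. ((\<lambda>R. \<Sum>k<n. z ^ k * V k R)
        \<longlongrightarrow> (\<Sum>k<n. z ^ k * (2 * of_real pi * \<i> / of_real (Gamma (\<alpha> * real k + 1))))) at_top"
      unfolding V_def using \<alpha> by (intro always_eventually allI tendsto_intros hankel) simp
    have "(\<lambda>n. 2 * of_real pi * \<i> * (\<Sum>k<n. z ^ k / of_real (Gamma (\<alpha> * real k + 1))))
        \<longlonglongrightarrow> 2 * of_real pi * \<i> * mittag_leffler \<alpha> z"
      using mittag_leffler_sums[OF \<alpha>, of z] unfolding sums_def by (intro tendsto_intros)
    then show "(\<lambda>n. \<Sum>k<n. z ^ k * (2 * of_real pi * \<i> / of_real (Gamma (\<alpha> * real k + 1))))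
        \<longlonglongrightarrow> 2 * of_real pi * \<i> * mittag_leffler \<alpha> z"
      by (simp add: sum_distrib_left mult_ac)
    show "uniform_limit {c..} (\<lambda>n R. \<Sum>k<n. z ^ k * V k R)
        (\<lambda>R. vertical_integral R (mittag_leffler_kernel \<alpha> v)) sequentially"
    proof (rule uniform_limitI)
      fix e :: real assume "e > 0"
      have "(\<lambda>n. \<rho> ^ n / (1 - \<rho>) * C) \<longlonglongrightarrow> 0 / (1 - \<rho>) * C"
        using \<rho> by (intro tendsto_intros LIMSEQ_power_zero) auto
      then have "\<forall>\<^sub>F n in sequentially. \<rho> ^ n / (1 - \<rho>) * C < e"
        using \<open>e > 0\<close> by (intro order_tendstoD(2)) auto
      then show "\<forall>\<^sub>F n in sequentially. \<forall>R\<in>{c..}.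
          dist (\<Sum>k<n. z ^ k * V k R) (vertical_integral R (mittag_leffler_kernel \<alpha> v)) < e"
      proof eventually_elim
        case (elim n)
        show ?case
        proof
          fix R assume "R \<in> {c..}"
          then have "c \<le> R" by simp
          have "dist (\<Sum>k<n. z ^ k * V k R) (vertical_integral R (mittag_leffler_kernel \<alpha> v))
              = cmod (vertical_integral R (rem n))"
            using partial[OF \<open>c \<le> R\<close>, of n] by (simp add: dist_norm norm_minus_commute)
          also have "\<dots> < e"
            using bound[OF \<open>c \<le> R\<close>, of n] elim by simp
          finally show "dist (\<Sum>k<n. z ^ k * V k R) (vertical_integral R (mittag_leffler_kernel \<alpha> v)) < e" .
        qed
      qed
    qed
    show "\<forall>\<^sub>F R in at_top. R \<in> {c..}"
      using eventually_ge_at_top[of c] by simp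
  qed simp
qed

section \<open>Lower bounds for the denominator of the kernel, and its pole\<close>

text \<open>The line through 0 in direction \<theta> has distance |sin \<theta>| from 1, and points
  of the closed left half-plane have distance at least 1 from 1.\<close>

lemma norm_one_minus_polar:
  fixes \<theta> :: real
  shows "\<bar>sin \<theta>\<bar> \<le> cmod (1 - exp (Complex r \<theta>))"
    and "cos \<theta> \<le> 0 \<Longrightarrow> 1 \<le> cmod (1 - exp (Complex r \<theta>))"
proof -
  have "1 - exp (Complex r \<theta>) = cis \<theta> * (cis (- \<theta>) - of_real (exp r))"
    by (simp add: ring_distribs cis_mult) (simp add: complex_eq_iff Re_exp Im_exp mult.commute)
  then have "cmod (1 - exp (Complex r \<theta>)) = cmod (cis (- \<theta>) - of_real (exp r))"
    by (simp add: norm_mult)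
  then show "\<bar>sin \<theta>\<bar> \<le> cmod (1 - exp (Complex r \<theta>))"
    using abs_Im_le_cmod[of "cis (- \<theta>) - of_real (exp r)"] by simp
  show "1 \<le> cmod (1 - exp (Complex r \<theta>))" if "cos \<theta> \<le> 0"
  proof -
    have "exp r * cos \<theta> \<le> 0"
      using that by (simp add: mult_nonneg_nonpos)
    then show ?thesis
      using complex_Re_le_cmod[of "1 - exp (Complex r \<theta>)"] by (simp add: Re_exp)
  qed
qed

text \<open>The pole has imaginary part - \<pi> / 2, so the two lines lie \<pi> / 2 below and 3
  \<pi> / 2 above it. The exponential then has the arguments \<beta> \<pi> / 2 and - 3 \<beta> \<pi>
  / 2.\<close>

lemma kernel_denominator_horizontal:
  assumes \<beta>: "0 < \<beta>" "\<beta> \<le> 1" and w: "\<bar>Im w\<bar> = pi"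
  shows "sin (\<beta> * pi / 2) \<le> cmod (1 - exp (- of_real \<beta> * (w - Complex u (- pi / 2))))"
proof -
  have exponent: "- of_real \<beta> * (w - Complex u (- pi / 2))
      = Complex (- \<beta> * (Re w - u)) (- \<beta> * (Im w + pi / 2))"
    by (simp add: complex_eq_iff)
  show ?thesis
  proof (cases "Im w = - pi")
    case True
    then have "- \<beta> * (Im w + pi / 2) = \<beta> * pi / 2"
      by (simp add: field_simps)
    then show ?thesis
      unfolding exponent using norm_one_minus_polar(1) by (metis abs_ge_self order.trans)
  next
    case False
    then have Im_w: "- \<beta> * (Im w + pi / 2) = - (3 * \<beta> * pi / 2)"
      using w by (simp add: abs_if field_simps split: if_splits)
    \<comment> \<open>The angle 3 \<beta> \<pi> / 2 is at most \<pi> / 2 in the first case, where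
      the sine increases, and lies between \<pi> / 2 and 3 \<pi> / 2 in the second, where the cosine
      is nonpositive.\<close>
    show ?thesis
    proof (cases "3 * \<beta> \<le> 1")
      case True
      have "sin (\<beta> * pi / 2) \<le> sin (3 * \<beta> * pi / 2)"
      proof -
        have "3 * \<beta> * pi \<le> 1 * pi" "0 \<le> \<beta> * pi"
          using \<beta> True by (intro mult_right_mono mult_nonneg_nonneg; simp)+
        then show ?thesis
          using pi_gt_zero by (intro sin_monotone_2pi_le) linarith+
      qed
      also have "\<dots> \<le> \<bar>sin (- (3 * \<beta> * pi / 2))\<bar>"
        by simp
      also have "\<dots> \<le> cmod (1 - exp (Complex (- \<beta> * (Re w - u)) (- (3 * \<beta> * pi / 2))))"
        by (rule norm_one_minus_polar)
      finally show ?thesis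
        unfolding exponent Im_w .
    next
      case False
      have "0 \<le> cos (3 * \<beta> * pi / 2 - pi)"
      proof -
        have "1 * pi \<le> 3 * \<beta> * pi" "\<beta> * pi \<le> 1 * pi"
          using \<beta> False by (intro mult_right_mono; simp)+
        then show ?thesis
          by (intro cos_ge_zero) linarith+
      qed
      then have "cos (- (3 * \<beta> * pi / 2)) \<le> 0"
        by (simp add: cos_diff)
      then have "1 \<le> cmod (1 - exp (Complex (- \<beta> * (Re w - u)) (- (3 * \<beta> * pi / 2))))"
        by (rule norm_one_minus_polar)
      then show ?thesis
        unfolding exponent Im_w using sin_le_one order.trans by blast
    qed
  qed
qed

text \<open>At horizontal distance at least 1 from the pole the exponential has modulus at least exp
  \<beta> or at most exp (- \<beta>), hence is away from the unit circle.\<close>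

lemma kernel_denominator_vertical:
  assumes \<beta>: "0 < \<beta>" "\<beta> \<le> 1" and w: "1 \<le> Re v - Re w \<or> 1 \<le> Re w - Re v"
  shows "\<beta> / 2 \<le> cmod (1 - exp (- of_real \<beta> * (w - v)))"
proof -
  have norm_q: "cmod (exp (- of_real \<beta> * (w - v))) = exp (\<beta> * (Re v - Re w))"
    by (simp add: algebra_simps)
  from w show ?thesis
  proof
    assume "1 \<le> Re v - Re w"
    then have "\<beta> \<le> \<beta> * (Re v - Re w)"
      using \<beta> by simp
    then have "1 + \<beta> \<le> exp (\<beta> * (Re v - Re w))"
      using exp_ge_add_one_self[of "\<beta> * (Re v - Re w)"] by linarith
    then show ?thesis
      using norm_triangle_ineq3[of 1 "exp (- of_real \<beta> * (w - v))"] \<beta> unfolding norm_q by simp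
  next
    assume "1 \<le> Re w - Re v"
    then have "\<beta> \<le> \<beta> * (Re w - Re v)"
      using \<beta> by simp
    then have "1 + \<beta> \<le> exp (\<beta> * (Re w - Re v))"
      using exp_ge_add_one_self[of "\<beta> * (Re w - Re v)"] by linarith
    moreover have "exp (\<beta> * (Re v - Re w)) = 1 / exp (\<beta> * (Re w - Re v))"
      by (simp add: exp_minus[symmetric] divide_inverse algebra_simps)
    ultimately have "exp (\<beta> * (Re v - Re w)) \<le> 1 / (1 + \<beta>)"
      using \<beta> by (simp add: frac_le)
    \<comment> \<open>The product (1 + \<beta>) (1 - \<beta> / 2) equals 1 + \<beta> (1 - \<beta>) /
      2, which is at least 1 for \<beta> \<le> 1.\<close>
    also have "\<dots> \<le> 1 - \<beta> / 2"
      using \<beta> mult_left_mono[of \<beta> 1 \<beta>] by (simp add: field_simps)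
    finally show ?thesis
      using norm_triangle_ineq2[of 1 "exp (- of_real \<beta> * (w - v))"] unfolding norm_q by simp
  qed
qed

text \<open>The zeros lie at distances 2 \<pi> |n| / \<beta> above and below the pole, thus at least
  2 \<pi> apart, while the strip reaches only \<pi> below and 2 \<pi> above it.\<close>

lemma kernel_denominator_nonzero:
  assumes \<beta>: "0 < \<beta>" "\<beta> \<le> 1" and w: "w \<noteq> Complex u (- pi / 2)" "\<bar>Im w\<bar> < 3 * pi / 2"
  shows "1 - exp (- of_real \<beta> * (w - Complex u (- pi / 2))) \<noteq> 0"
proof
  assume "1 - exp (- of_real \<beta> * (w - Complex u (- pi / 2))) = 0"
  then have "exp (- of_real \<beta> * (w - Complex u (- pi / 2))) = 1"
    by simp
  then obtain n :: int where Re: "Re w = u" and n: "- \<beta> * (Im w + pi / 2) = of_int (2 * n) * pi"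
    unfolding exp_eq_1 using \<beta> by auto
  have Im_w: "- pi < Im w + pi / 2" "Im w + pi / 2 < 2 * pi"
    using w(2) by auto
  then have "\<beta> * (Im w + pi / 2) < 2 * pi" "- pi < \<beta> * (Im w + pi / 2)"
  proof -
    have "\<beta> * (Im w + pi / 2) < \<beta> * (2 * pi)" "\<beta> * (- pi) < \<beta> * (Im w + pi / 2)"
      using \<beta> Im_w by (intro mult_strict_left_mono; simp)+
    moreover have "\<beta> * (2 * pi) \<le> 1 * (2 * pi)" "\<beta> * pi \<le> 1 * pi"
      using \<beta> by (intro mult_right_mono; simp)+
    then have "\<beta> * (2 * pi) \<le> 2 * pi" "- pi \<le> \<beta> * (- pi)"
      by simp_all
    ultimately show "\<beta> * (Im w + pi / 2) < 2 * pi" "- pi < \<beta> * (Im w + pi / 2)"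
      by (blast intro: less_le_trans le_less_trans)+
  qed
  moreover have n': "of_int (- 2 * n) * pi = \<beta> * (Im w + pi / 2)"
    using n by simp
  ultimately have "(- 1) * pi < of_int (- 2 * n) * pi" "of_int (- 2 * n) * pi < 2 * pi"
    unfolding n' by simp_all
  then have "- 1 < real_of_int (- 2 * n)" "real_of_int (- 2 * n) < 2"
    by (simp_all only: mult_less_cancel_right_pos[OF pi_gt_zero])
  then have "n = 0" by linarith
  with n \<beta> have "Im w = - pi / 2" by simp
  with Re w(1) show False by (simp add: complex_eq_iff)
qed

text \<open>This is the residue at the pole. It depends on \<beta> only through the factor 1 /
  \<beta>, so the \<alpha>-kernel and 1 / \<alpha> times the 1-kernel have the same residue.\<close>

lemma kernel_pole:
  assumes "0 < \<beta>"
  shows "((\<lambda>w. (w - v) * mittag_leffler_kernel \<beta> v w) \<longlongrightarrow> exp (exp v) / of_real \<beta>) (at v)"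
proof -
  have "((\<lambda>w. 1 - exp (- of_real \<beta> * (w - v))) has_field_derivative of_real \<beta>) (at v)"
    by (auto intro!: derivative_eq_intros)
  then have "((\<lambda>w. (1 - exp (- of_real \<beta> * (w - v))) / (w - v)) \<longlongrightarrow> of_real \<beta>) (at v)"
    unfolding has_field_derivative_iff by simp
  then have "((\<lambda>w. exp (exp w) * inverse ((1 - exp (- of_real \<beta> * (w - v))) / (w - v)))
      \<longlongrightarrow> exp (exp v) * inverse (of_real \<beta>)) (at v)"
    using assms by (intro tendsto_intros) auto
  then show ?thesis
    by (simp add: mittag_leffler_kernel_def[abs_def] field_simps)
qed

text \<open>
  On the critical ray the pole of the kernel contributes \<open>exp y / \<alpha>\<close> with \<open>\<bar>exp y\<bar> = 1\<close>. It is removed by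
  subtracting a multiple of the kernel of \<open>mittag_leffler 1\<close> with the same pole; the difference then
  is bounded on a contour that stays at distance at least 1 from the pole.
\<close>

lemma mittag_leffler_bound:
  assumes \<alpha>: "0 < \<alpha>" "\<alpha> < 1" and x: "0 \<le> x"
  shows "cmod (mittag_leffler \<alpha> (exp (- \<i> * complex_of_real (\<alpha> * pi / 2)) * of_real x))
    \<le> 1 / \<alpha> + (4 / \<alpha> + 1 / sin (\<alpha> * pi / 2)) * (exp (exp 2) + 1)"
    (is "_ \<le> 1 / \<alpha> + ?B * _")
proof (cases "x = 0")
  \<comment> \<open>Zero has no logarithm; here the value 1 of the function is at most 1 /
    \<alpha>.\<close>
  case True
  have "0 < sin (\<alpha> * pi / 2)"
    using \<alpha> by (intro sin_gt_zero) auto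
  then have "0 \<le> ?B * (exp (exp 2) + 1)"
    using \<alpha> by (intro mult_nonneg_nonneg add_nonneg_nonneg) auto
  then show ?thesis
    using True \<alpha> by (simp add: mittag_leffler_0 add_increasing2)
next
  case False
  \<comment> \<open>Chosen so that exp (\<alpha> v) is the given point of the ray.\<close>
  define u where "u = ln x / \<alpha>"
  define v where "v = Complex u (- pi / 2)"
  \<comment> \<open>An open strip around the contour in which \<open>v\<close> is the only pole of
    both kernels.\<close>
  define S where "S = {w. \<bar>Im w\<bar> < 3 * pi / 2}"
  define D where "D w = mittag_leffler_kernel \<alpha> v w - of_real (1 / \<alpha>) * mittag_leffler_kernel 1 v w" for w
  \<comment> \<open>For u \<ge> 1 the contour passes the pole on the left at distance u, otherwise
    on the right at distance 2 - u > 1. In both cases c lies in [0, 2], which makes the bound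
    uniform in x.\<close>
  define c :: real where "c = (if 1 \<le> u then 0 else 2)"
  have norm_2_pi_i: "cmod (2 * of_real pi * \<i> * z) = 2 * pi * cmod z" for z
    by (simp add: norm_mult)
  have sin_pos: "0 < sin (\<alpha> * pi / 2)"
    using \<alpha> by (intro sin_gt_zero) auto
  have S_eq: "S = {w. - (3 * pi / 2) < Im w} \<inter> {w. Im w < 3 * pi / 2}"
    by (auto simp: S_def)
  have S: "open S" "convex S"
    unfolding S_eq
    by (intro convex_Int open_Int open_halfspace_Im_gt open_halfspace_Im_lt
        convex_halfspace_Im_gt convex_halfspace_Im_lt)+
  have vS: "v \<in> S" by (simp add: v_def S_def)
  have hol: "mittag_leffler_kernel \<beta> v holomorphic_on S - {v}" if "0 < \<beta>" "\<beta> \<le> 1" for \<beta>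
    unfolding mittag_leffler_kernel_def[abs_def]
  proof (intro holomorphic_intros)
    fix w assume "w \<in> S - {v}"
    then show "1 - exp (- complex_of_real \<beta> * (w - v)) \<noteq> 0"
      using kernel_denominator_nonzero[OF that] by (simp add: v_def S_def)
  qed
  have hol_D: "D holomorphic_on S - {v}"
    unfolding D_def using \<alpha> by (intro holomorphic_intros hol) auto
  have "((\<lambda>w. (w - v) * mittag_leffler_kernel \<alpha> v w - of_real (1 / \<alpha>) * ((w - v) * mittag_leffler_kernel 1 v w))
      \<longlongrightarrow> exp (exp v) / of_real \<alpha> - of_real (1 / \<alpha>) * (exp (exp v) / of_real 1)) (at v)"
    using \<alpha> by (intro tendsto_intros kernel_pole) auto
  then have "((\<lambda>w. (w - v) * D w) \<longlongrightarrow> 0) (at v)"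
    unfolding D_def right_diff_distrib by (simp add: mult.left_commute)
  then obtain f where f: "f holomorphic_on S" "\<And>w. w \<in> S - {v} \<Longrightarrow> f w = D w"
    using holomorphic_on_extend_lim[OF hol_D] vS S(1) by (metis interior_open)
  have bound: "cmod (vertical_integral R f) \<le> ?B * (2 * pi * exp (exp c) + 2)" if "c \<le> R" for R
  proof (rule vertical_integral_bound[OF f(1) S])
    fix w assume w: "c \<le> Re w" "\<bar>Im w\<bar> \<le> pi" "Re w = c \<or> \<bar>Im w\<bar> = pi"
    have ratio: "cmod (mittag_leffler_kernel \<beta> v w) \<le> 1 / d * cmod (exp (exp w))"
      if "0 < d" "d \<le> cmod (1 - exp (- of_real \<beta> * (w - v)))" for \<beta> d
      using that by (simp add: mittag_leffler_kernel_def norm_divide frac_le)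
    have D_le: "cmod (D w) \<le> cmod (mittag_leffler_kernel \<alpha> v w) + 1 / \<alpha> * cmod (mittag_leffler_kernel 1 v w)"
      unfolding D_def using \<alpha> norm_triangle_ineq4 by (metis abs_of_pos norm_mult norm_of_real zero_less_divide_1_iff)
    have "w \<noteq> v \<and> cmod (D w) \<le> ?B * cmod (exp (exp w))"
    proof (cases "\<bar>Im w\<bar> = pi")
      case True
      have "cmod (mittag_leffler_kernel \<alpha> v w) \<le> 1 / sin (\<alpha> * pi / 2) * cmod (exp (exp w))"
        unfolding v_def using \<alpha> True kernel_denominator_horizontal[of \<alpha> w u]
        by (intro ratio[unfolded v_def] sin_pos) auto
      moreover have "cmod (mittag_leffler_kernel 1 v w) \<le> 1 / 1 * cmod (exp (exp w))"
        using True kernel_denominator_horizontal[of 1 w u]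
        by (intro ratio) (auto simp: v_def)
      ultimately have "cmod (D w) \<le> 1 / sin (\<alpha> * pi / 2) * cmod (exp (exp w)) + 1 / \<alpha> * (1 / 1 * cmod (exp (exp w)))"
        using \<alpha> by (intro order.trans[OF D_le] add_mono mult_left_mono) auto
      also have "\<dots> \<le> ?B * cmod (exp (exp w))"
        using \<alpha> by (simp add: field_simps)
      finally show ?thesis
        using True by (auto simp: v_def)
    next
      case False
      then have "Re w = c" using w by simp
      then have dist: "1 \<le> Re v - Re w \<or> 1 \<le> Re w - Re v"
        by (auto simp: c_def v_def)
      have "cmod (mittag_leffler_kernel \<alpha> v w) \<le> 1 / (\<alpha> / 2) * cmod (exp (exp w))"
        using \<alpha> kernel_denominator_vertical[OF _ _ dist, of \<alpha>] by (intro ratio) auto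
      moreover have "cmod (mittag_leffler_kernel 1 v w) \<le> 1 / (1 / 2) * cmod (exp (exp w))"
        using kernel_denominator_vertical[OF _ _ dist, of 1] by (intro ratio) auto
      ultimately have "cmod (D w) \<le> 1 / (\<alpha> / 2) * cmod (exp (exp w)) + 1 / \<alpha> * (1 / (1 / 2) * cmod (exp (exp w)))"
        using \<alpha> by (intro order.trans[OF D_le] add_mono mult_left_mono) auto
      also have "\<dots> = 4 / \<alpha> * cmod (exp (exp w))"
        by simp
      also have "\<dots> \<le> ?B * cmod (exp (exp w))"
        using sin_pos by (intro mult_right_mono) auto
      finally show ?thesis
        using dist by auto
    qed
    moreover have "w \<in> S"
      using w by (simp add: S_def) (use pi_gt_zero in linarith)
    ultimately show "cmod (f w) \<le> ?B * cmod (exp (exp w))"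
      using f(2) by auto
  next
    show "{w. c \<le> Re w \<and> \<bar>Im w\<bar> \<le> pi} \<subseteq> S"
      using pi_gt_zero by (auto simp: S_def simp del: pi_gt_zero)
  qed (use that in \<open>auto simp: c_def\<close>)
  have "((\<lambda>R. vertical_integral R (mittag_leffler_kernel \<alpha> v) - of_real (1 / \<alpha>) * vertical_integral R (mittag_leffler_kernel 1 v))
      \<longlongrightarrow> 2 * of_real pi * \<i> * mittag_leffler \<alpha> (exp (of_real \<alpha> * v))
        - of_real (1 / \<alpha>) * (2 * of_real pi * \<i> * mittag_leffler 1 (exp (of_real 1 * v)))) at_top"
    using \<alpha> by (intro tendsto_intros mittag_leffler_contour) auto
  moreover have "\<forall>\<^sub>F R in at_top. cmod (vertical_integral R (mittag_leffler_kernel \<alpha> v)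
      - of_real (1 / \<alpha>) * vertical_integral R (mittag_leffler_kernel 1 v)) \<le> ?B * (2 * pi * exp (exp c) + 2)"
    \<comment> \<open>To the right of the pole the segment lies where \<open>f\<close> and
      \<open>D\<close> agree.\<close>
    using eventually_ge_at_top[of "max c (u + 1)"]
  proof eventually_elim
    case (elim R)
    have sub: "{w. Re w = R \<and> \<bar>Im w\<bar> \<le> pi} \<subseteq> S - {v}"
      using elim pi_gt_zero by (auto simp: S_def v_def simp del: pi_gt_zero)
    have "vertical_integral R f = vertical_integral R D"
      unfolding vertical_integral_def
      by (rule contour_integral_eq) (use f(2) sub in \<open>auto simp: vertical_segment\<close>)
    also have "\<dots> = vertical_integral R (mittag_leffler_kernel \<alpha> v)
        - of_real (1 / \<alpha>) * vertical_integral R (mittag_leffler_kernel 1 v)"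
      unfolding D_def using \<alpha> sub by (intro vertical_integral_lincomb[of _ "S - {v}"] hol) auto
    finally show ?case
      using bound[of R] elim by simp
  qed
  ultimately have "cmod (2 * of_real pi * \<i> * mittag_leffler \<alpha> (exp (of_real \<alpha> * v))
        - of_real (1 / \<alpha>) * (2 * of_real pi * \<i> * mittag_leffler 1 (exp (of_real 1 * v))))
      \<le> ?B * (2 * pi * exp (exp c) + 2)"
    by (intro tendsto_upperbound[OF tendsto_norm]) auto
  also have "2 * of_real pi * \<i> * mittag_leffler \<alpha> (exp (of_real \<alpha> * v))
        - of_real (1 / \<alpha>) * (2 * of_real pi * \<i> * mittag_leffler 1 (exp (of_real 1 * v)))
      = 2 * of_real pi * \<i> * (mittag_leffler \<alpha> (exp (of_real \<alpha> * v)) - of_real (1 / \<alpha>) * exp (exp v))"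
    by (simp add: mittag_leffler_1 algebra_simps)
  also have "?B * (2 * pi * exp (exp c) + 2) \<le> ?B * (2 * pi * (exp (exp 2) + 1))"
  proof (rule mult_left_mono)
    have "exp (exp c) \<le> exp (exp 2)" by (simp add: c_def)
    then have "2 * pi * exp (exp c) \<le> 2 * pi * exp (exp 2)"
      by (intro mult_left_mono) auto
    then show "2 * pi * exp (exp c) + 2 \<le> 2 * pi * (exp (exp 2) + 1)"
      unfolding ring_distribs using pi_ge_two by linarith
  qed (use \<alpha> sin_pos in auto)
  also have "\<dots> = 2 * pi * (?B * (exp (exp 2) + 1))"
    by (simp only: mult.left_commute)
  finally have "2 * pi * cmod (mittag_leffler \<alpha> (exp (of_real \<alpha> * v)) - of_real (1 / \<alpha>) * exp (exp v))
      \<le> 2 * pi * (?B * (exp (exp 2) + 1))"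
    by (simp only: norm_2_pi_i)
  then have main: "cmod (mittag_leffler \<alpha> (exp (of_real \<alpha> * v)) - of_real (1 / \<alpha>) * exp (exp v))
      \<le> ?B * (exp (exp 2) + 1)"
    by (rule mult_left_le_imp_le) simp
  \<comment> \<open>Since Im v = - \<pi> / 2, exp v is purely imaginary.\<close>
  have "cmod (of_real (1 / \<alpha>) * exp (exp v)) = 1 / \<alpha>"
    using \<alpha> by (simp add: v_def norm_mult norm_exp_exp Re_exp norm_divide)
  moreover have "exp (of_real \<alpha> * v) = exp (- \<i> * complex_of_real (\<alpha> * pi / 2)) * of_real x"
  proof -
    have "of_real \<alpha> * v = - \<i> * complex_of_real (\<alpha> * pi / 2) + of_real (ln x)"
      using \<alpha> by (simp add: v_def u_def complex_eq_iff)
    then show ?thesis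
      using x False by (simp only: exp_add exp_of_real) simp
  qed
  ultimately show ?thesis
    using main norm_triangle_sub[of "mittag_leffler \<alpha> (exp (of_real \<alpha> * v))" "of_real (1 / \<alpha>) * exp (exp v)"]
    by simp
qed

section \<open>Multiplication operators\<close>

lemma scaleC_uminus_1: "(- 1) *\<^sub>C x = - (x :: 'h::complex_hilbert_space)"
  using scaleC_of_real[of "- 1" x] by simp

lemma cinner_add_right: "cinner x (y + z) = cinner x y + cinner x (z :: 'h::complex_hilbert_space)"
  using cinner_add_left[of y z x] by (metis cinner_commute complex_cnj_add)

lemma cinner_diff_right: "cinner x (y - z) = cinner x y - cinner x (z :: 'h::complex_hilbert_space)"
  using cinner_add_right[of x "y - z" z] by simp

lemma cinner_self: "cinner x x = of_real ((norm (x :: 'h::complex_hilbert_space))\<^sup>2)"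
proof -
  have "Im (cinner x x) = 0"
    using cinner_commute[of x x] by (simp add: complex_eq_iff)
  then show ?thesis
    by (simp add: complex_eq_iff power2_norm_eq_inner inner_eq_Re_cinner)
qed

lemma cinner_right_unique:
  assumes "\<And>x. cinner x y = cinner x (z :: 'h::complex_hilbert_space)"
  shows "y = z"
  using assms[of "y - z"] cinner_self[of "y - z"] by (simp add: cinner_diff_right)

section \<open>Square integrable functions and bounded multipliers\<close>

lemma L2_dominated:
  assumes h: "h \<in> L2 M" and g: "g \<in> borel_measurable M" and le: "AE \<omega> in M. cmod (g \<omega>) \<le> cmod (h \<omega>)"
  shows "g \<in> L2 M"
proof -
  have [measurable]: "g \<in> borel_measurable M" by (rule g)
  have "integrable M (\<lambda>\<omega>. (cmod (h \<omega>))\<^sup>2)"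
    using h by (simp add: L2_def)
  then have "integrable M (\<lambda>\<omega>. (cmod (g \<omega>))\<^sup>2)"
  proof (rule Bochner_Integration.integrable_bound)
    show "AE \<omega> in M. norm ((cmod (g \<omega>))\<^sup>2) \<le> norm ((cmod (h \<omega>))\<^sup>2)"
      using le by eventually_elim (simp add: power_mono)
  qed measurable
  then show ?thesis using g by (simp add: L2_def)
qed

lemma L2_scale:
  assumes "f \<in> L2 M"
  shows "(\<lambda>\<omega>. c * f \<omega>) \<in> L2 M"
  using assms by (auto simp: L2_def norm_mult power_mult_distrib)

lemma L2_add:
  assumes f: "f \<in> L2 M" and g: "g \<in> L2 M"
  shows "(\<lambda>\<omega>. f \<omega> + g \<omega>) \<in> L2 M"
proof -
  have [measurable]: "f \<in> borel_measurable M" "g \<in> borel_measurable M"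
    using f g by (auto simp: L2_def)
  have "integrable M (\<lambda>\<omega>. 2 * (cmod (f \<omega>))\<^sup>2 + 2 * (cmod (g \<omega>))\<^sup>2)"
    using f g by (auto simp: L2_def)
  then have "integrable M (\<lambda>\<omega>. (cmod (f \<omega> + g \<omega>))\<^sup>2)"
  proof (rule Bochner_Integration.integrable_bound)
    have "(cmod (f \<omega> + g \<omega>))\<^sup>2 \<le> 2 * (cmod (f \<omega>))\<^sup>2 + 2 * (cmod (g \<omega>))\<^sup>2" for \<omega>
    proof -
      have "(cmod (f \<omega> + g \<omega>))\<^sup>2 \<le> (cmod (f \<omega>) + cmod (g \<omega>))\<^sup>2"
        by (intro power_mono norm_triangle_ineq) simp
      also have "\<dots> \<le> 2 * (cmod (f \<omega>))\<^sup>2 + 2 * (cmod (g \<omega>))\<^sup>2"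
        using sum_squares_bound[of "cmod (f \<omega>)" "cmod (g \<omega>)"] by (simp add: power2_sum)
      finally show ?thesis .
    qed
    then show "AE \<omega> in M. norm ((cmod (f \<omega> + g \<omega>))\<^sup>2) \<le> norm (2 * (cmod (f \<omega>))\<^sup>2 + 2 * (cmod (g \<omega>))\<^sup>2)"
      by (auto simp: abs_of_nonneg)
  qed measurable
  then show ?thesis by (simp add: L2_def)
qed

lemma L2_diff: "f \<in> L2 M \<Longrightarrow> g \<in> L2 M \<Longrightarrow> (\<lambda>\<omega>. f \<omega> - g \<omega>) \<in> L2 M"
  using L2_add[of f M "\<lambda>\<omega>. - 1 * g \<omega>"] L2_scale[of g M "- 1"] by simp

text \<open>The bound is essential: \<open>a\<close> is nonnegative only almost everywhere, and the
  estimate for the Mittag-Leffler function is available only on the ray.\<close>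

definition bounded_multiplier :: "'w measure \<Rightarrow> ('w \<Rightarrow> complex) \<Rightarrow> bool" where
  "bounded_multiplier M m \<longleftrightarrow> m \<in> borel_measurable M \<and> (\<exists>B. AE \<omega> in M. cmod (m \<omega>) \<le> B)"

lemma L2_multiplier:
  assumes m: "bounded_multiplier M m" and f: "f \<in> L2 M"
  shows "(\<lambda>\<omega>. m \<omega> * f \<omega>) \<in> L2 M"
proof -
  obtain B where B: "AE \<omega> in M. cmod (m \<omega>) \<le> B"
    using m by (auto simp: bounded_multiplier_def)
  have [measurable]: "m \<in> borel_measurable M" "f \<in> borel_measurable M"
    using m f by (auto simp: bounded_multiplier_def L2_def)
  show ?thesis
  proof (rule L2_dominated[OF L2_scale[OF f, of "of_real B"]])
    show "AE \<omega> in M. cmod (m \<omega> * f \<omega>) \<le> cmod (complex_of_real B * f \<omega>)"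
      using B by eventually_elim (auto simp: norm_mult intro!: mult_right_mono)
  qed measurable
qed

lemma bounded_multiplier_mult:
  assumes "bounded_multiplier M m" "bounded_multiplier M n"
  shows "bounded_multiplier M (\<lambda>\<omega>. m \<omega> * n \<omega>)"
proof -
  obtain B C where "AE \<omega> in M. cmod (m \<omega>) \<le> B" "AE \<omega> in M. cmod (n \<omega>) \<le> C"
    using assms by (auto simp: bounded_multiplier_def)
  then have "AE \<omega> in M. cmod (m \<omega> * n \<omega>) \<le> \<bar>B\<bar> * \<bar>C\<bar>"
    by eventually_elim (auto simp: norm_mult intro!: mult_mono)
  then show ?thesis
    using assms by (auto simp: bounded_multiplier_def)
qed

lemma bounded_multiplier_cnj:
  "bounded_multiplier M m \<Longrightarrow> bounded_multiplier M (\<lambda>\<omega>. cnj (m \<omega>))"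
  by (auto simp: bounded_multiplier_def
      intro: measurable_compose[OF _ borel_measurable_continuous_onI[of cnj]] continuous_intros)

section \<open>Transport to the Hilbert space by W\<close>

locale L2_model =
  fixes M :: "'w measure" and W :: "('w \<Rightarrow> complex) \<Rightarrow> 'h::complex_hilbert_space"
  assumes unitary: "unitary_L2 M W"
begin

lemma W_add: "f \<in> L2 M \<Longrightarrow> g \<in> L2 M \<Longrightarrow> W (\<lambda>\<omega>. f \<omega> + g \<omega>) = W f + W g"
  using unitary by (simp add: unitary_L2_def)

lemma W_scale: "f \<in> L2 M \<Longrightarrow> W (\<lambda>\<omega>. c * f \<omega>) = c *\<^sub>C W f"
  using unitary by (simp add: unitary_L2_def)

lemma W_cinner: "f \<in> L2 M \<Longrightarrow> g \<in> L2 M \<Longrightarrow> cinner (W f) (W g) = (LINT \<omega>|M. f \<omega> * cnj (g \<omega>))"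
  using unitary by (simp add: unitary_L2_def)

lemma W_diff: "f \<in> L2 M \<Longrightarrow> g \<in> L2 M \<Longrightarrow> W (\<lambda>\<omega>. f \<omega> - g \<omega>) = W f - W g"
  using W_add[of f "\<lambda>\<omega>. - 1 * g \<omega>"] W_scale[of g "- 1"] L2_scale[of g M "- 1"]
  by (simp add: scaleC_uminus_1)

definition rep :: "'h \<Rightarrow> 'w \<Rightarrow> complex" where
  "rep = inv_into (L2 M) W"

lemma rep: "rep \<phi> \<in> L2 M" "W (rep \<phi>) = \<phi>"
proof -
  have "\<phi> \<in> W ` L2 M"
    using unitary by (simp add: unitary_L2_def)
  then show "rep \<phi> \<in> L2 M" "W (rep \<phi>) = \<phi>"
    unfolding rep_def by (simp_all add: inv_into_into f_inv_into_f)
qed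

lemma norm_W: "f \<in> L2 M \<Longrightarrow> (norm (W f))\<^sup>2 = (LINT \<omega>|M. (cmod (f \<omega>))\<^sup>2)"
proof -
  assume f: "f \<in> L2 M"
  have "complex_of_real ((norm (W f))\<^sup>2) = (LINT \<omega>|M. complex_of_real ((cmod (f \<omega>))\<^sup>2))"
    using W_cinner[OF f f] unfolding cinner_self complex_norm_square .
  then show ?thesis
    by (simp only: integral_complex_of_real of_real_eq_iff)
qed

lemma norm_W_cong:
  assumes "f \<in> L2 M" "g \<in> L2 M" "\<And>\<omega>. cmod (f \<omega>) = cmod (g \<omega>)"
  shows "norm (W f) = norm (W g)"
  using norm_W[OF assms(1)] norm_W[OF assms(2)] assms(3)
  by (intro power2_eq_imp_eq[of "norm (W f)"]) simp_all

text \<open>By isometry the norm of W (f - g) is the norm of f - g in \<open>L2 M\<close>. Hence the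
  choice of representative made by \<open>rep\<close> does not affect values of W.\<close>

lemma W_eq_iff:
  assumes f: "f \<in> L2 M" and g: "g \<in> L2 M"
  shows "W f = W g \<longleftrightarrow> (AE \<omega> in M. f \<omega> = g \<omega>)"
proof -
  have fg: "(\<lambda>\<omega>. f \<omega> - g \<omega>) \<in> L2 M"
    using f g by (rule L2_diff)
  have "W f = W g \<longleftrightarrow> (norm (W (\<lambda>\<omega>. f \<omega> - g \<omega>)))\<^sup>2 = 0"
    using W_diff[OF f g] by simp
  also have "\<dots> \<longleftrightarrow> (AE \<omega> in M. (cmod (f \<omega> - g \<omega>))\<^sup>2 = 0)"
    unfolding norm_W[OF fg]
    by (rule integral_nonneg_eq_0_iff_AE) (use fg in \<open>auto simp: L2_def\<close>)
  finally show ?thesis by simp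
qed

lemma mult_operator_rep:
  assumes "bounded_multiplier M m"
  shows "mult_operator M W m \<phi> = Some (W (\<lambda>\<omega>. m \<omega> * rep \<phi> \<omega>))"
  using L2_multiplier[OF assms rep(1)] by (simp add: mult_operator_def rep_def)

text \<open>Evaluates the operator on any representative, since the one chosen by \<open>rep\<close>
  differs from it only on a null set.\<close>

lemma mult_operator_W:
  assumes m: "bounded_multiplier M m" and f: "f \<in> L2 M"
  shows "mult_operator M W m (W f) = Some (W (\<lambda>\<omega>. m \<omega> * f \<omega>))"
proof -
  have "AE \<omega> in M. rep (W f) \<omega> = f \<omega>"
    using W_eq_iff[OF rep(1) f] rep(2) by metis
  then have "AE \<omega> in M. m \<omega> * rep (W f) \<omega> = m \<omega> * f \<omega>"
    by eventually_elim simp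
  then show ?thesis
    using m f rep(1) by (simp add: mult_operator_rep W_eq_iff L2_multiplier)
qed

lemma dom_mult_operator: "bounded_multiplier M m \<Longrightarrow> dom (mult_operator M W m) = UNIV"
  by (auto simp: mult_operator_rep)

lemma mult_operator_comp:
  assumes m: "bounded_multiplier M m" and n: "bounded_multiplier M n"
  shows "mult_operator M W m \<circ>\<^sub>m mult_operator M W n = mult_operator M W (\<lambda>\<omega>. m \<omega> * n \<omega>)"
proof
  fix \<phi>
  show "(mult_operator M W m \<circ>\<^sub>m mult_operator M W n) \<phi> = mult_operator M W (\<lambda>\<omega>. m \<omega> * n \<omega>) \<phi>"
    using m n by (simp add: map_comp_def mult_operator_rep[OF n] mult_operator_W L2_multiplier rep(1)
        mult_operator_rep[OF bounded_multiplier_mult[OF m n]] mult.assoc)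
qed

text \<open>Moving m across the integral gives a vector z with the adjoint property. As the operator
  is defined everywhere, testing against all vectors shows that z is the only one.\<close>

lemma op_adjoint_mult_operator:
  assumes m: "bounded_multiplier M m"
  shows "op_adjoint (mult_operator M W m) = mult_operator M W (\<lambda>\<omega>. cnj (m \<omega>))"
proof
  fix \<psi>
  define z where "z = W (\<lambda>\<omega>. cnj (m \<omega>) * rep \<psi> \<omega>)"
  have m': "bounded_multiplier M (\<lambda>\<omega>. cnj (m \<omega>))"
    using m by (rule bounded_multiplier_cnj)
  have adj: "cinner (the (mult_operator M W m \<phi>)) \<psi> = cinner \<phi> z" for \<phi>
  proof -
    have "cinner (the (mult_operator M W m \<phi>)) \<psi> = cinner (W (\<lambda>\<omega>. m \<omega> * rep \<phi> \<omega>)) (W (rep \<psi>))"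
      by (simp add: mult_operator_rep[OF m] rep(2))
    also have "\<dots> = cinner (W (rep \<phi>)) z"
      unfolding z_def using m m' rep(1) by (simp add: W_cinner L2_multiplier mult_ac)
    finally show ?thesis by (simp add: rep(2))
  qed
  have "(\<forall>\<phi>\<in>dom (mult_operator M W m). cinner (the (mult_operator M W m \<phi>)) \<psi> = cinner \<phi> z') \<longleftrightarrow> z' = z" for z'
    using adj cinner_right_unique[of z' z] by (auto simp: dom_mult_operator[OF m])
  then show "op_adjoint (mult_operator M W m) \<psi> = mult_operator M W (\<lambda>\<omega>. cnj (m \<omega>)) \<psi>"
    unfolding op_adjoint_def mult_operator_rep[OF m'] z_def by simp
qed

text \<open>Dominated convergence in the Hilbert space. The filter covers both the left limit in
  \<alpha> and difference quotients in t. Passing to sequences leaves only countably many of the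
  null sets that depend on s.\<close>

lemma W_tendsto:
  fixes g :: "real \<Rightarrow> 'w \<Rightarrow> complex"
  assumes h: "h \<in> L2 M" and g0: "g0 \<in> borel_measurable M"
    and g: "\<forall>\<^sub>F s in at x within S. g s \<in> borel_measurable M \<and> (AE \<omega> in M. cmod (g s \<omega>) \<le> cmod (h \<omega>))"
    and lim: "AE \<omega> in M. ((\<lambda>s. g s \<omega>) \<longlongrightarrow> g0 \<omega>) (at x within S)"
  shows "((\<lambda>s. W (g s)) \<longlongrightarrow> W g0) (at x within S)"
proof -
  define good where "good s \<longleftrightarrow> g s \<in> borel_measurable M \<and> (AE \<omega> in M. cmod (g s \<omega>) \<le> cmod (h \<omega>))" for s
  have good: "\<forall>\<^sub>F s in at x within S. good s"
    using g by (simp add: good_def)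
  have limX: "(\<lambda>n. W (g (X n))) \<longlonglongrightarrow> W g0"
    if X: "filterlim X (at x within S) sequentially" and goodX: "\<And>n. good (X n)" for X
  proof -
    have gX: "g (X n) \<in> borel_measurable M" "AE \<omega> in M. cmod (g (X n) \<omega>) \<le> cmod (h \<omega>)" for n
      using goodX[of n] by (auto simp: good_def)
    have limX: "AE \<omega> in M. (\<lambda>n. g (X n) \<omega>) \<longlonglongrightarrow> g0 \<omega>"
      using lim by eventually_elim (rule filterlim_compose[OF _ X])
    have all: "AE \<omega> in M. \<forall>n. cmod (g (X n) \<omega>) \<le> cmod (h \<omega>)"
      using gX(2) by (simp add: AE_all_countable)
    have le0: "AE \<omega> in M. cmod (g0 \<omega>) \<le> cmod (h \<omega>)"
      using limX all by eventually_elim (auto intro: LIMSEQ_le_const2[OF tendsto_norm])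
    have g0_L2: "g0 \<in> L2 M"
      by (rule L2_dominated[OF h g0 le0])
    have gX_L2: "g (X n) \<in> L2 M" for n
      by (rule L2_dominated[OF h gX])
    have [measurable]: "g (X n) \<in> borel_measurable M" "g0 \<in> borel_measurable M" "h \<in> borel_measurable M" for n
      using gX(1) g0 h by (auto simp: L2_def)
    have "(\<lambda>n. LINT \<omega>|M. (cmod (g (X n) \<omega> - g0 \<omega>))\<^sup>2) \<longlonglongrightarrow> (LINT \<omega>|M. 0)"
    proof (rule integral_dominated_convergence)
      \<comment> \<open>Both the functions and their limit are bounded by h, so their difference is
        bounded by 2 |h|.\<close>
      show "integrable M (\<lambda>\<omega>. 4 * (cmod (h \<omega>))\<^sup>2)"
        using h by (simp add: L2_def)
      show "AE \<omega> in M. (\<lambda>n. (cmod (g (X n) \<omega> - g0 \<omega>))\<^sup>2) \<longlonglongrightarrow> 0"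
        using limX
      proof eventually_elim
        case (elim \<omega>)
        have "(\<lambda>n. (cmod (g (X n) \<omega> - g0 \<omega>))\<^sup>2) \<longlonglongrightarrow> (cmod (g0 \<omega> - g0 \<omega>))\<^sup>2"
          by (intro tendsto_intros elim)
        then show ?case by simp
      qed
      show "AE \<omega> in M. norm ((cmod (g (X n) \<omega> - g0 \<omega>))\<^sup>2) \<le> 4 * (cmod (h \<omega>))\<^sup>2" for n
        using gX(2)[of n] le0
      proof eventually_elim
        case (elim \<omega>)
        then have "cmod (g (X n) \<omega> - g0 \<omega>) \<le> 2 * cmod (h \<omega>)"
          using norm_triangle_ineq4[of "g (X n) \<omega>" "g0 \<omega>"] by simp
        then have "(cmod (g (X n) \<omega> - g0 \<omega>))\<^sup>2 \<le> (2 * cmod (h \<omega>))\<^sup>2"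
          by (rule power_mono) simp
        then show ?case by (simp add: power_mult_distrib)
      qed
    qed measurable
    then have "(\<lambda>n. (norm (W (g (X n)) - W g0))\<^sup>2) \<longlonglongrightarrow> 0"
      by (simp add: norm_W[symmetric] L2_diff gX_L2 g0_L2 W_diff)
    then have "(\<lambda>n. sqrt ((norm (W (g (X n)) - W g0))\<^sup>2)) \<longlonglongrightarrow> sqrt 0"
      by (rule tendsto_real_sqrt)
    then have "(\<lambda>n. W (g (X n)) - W g0) \<longlonglongrightarrow> 0"
      by (simp add: tendsto_norm_zero_iff)
    then show ?thesis by (simp add: LIM_zero_iff)
  qed
  show ?thesis
    unfolding tendsto_at_iff_sequentially
  proof (intro allI impI)
    fix X assume "\<forall>i. X i \<in> S - {x}" "X \<longlonglongrightarrow> x"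
    then have X: "filterlim X (at x within S) sequentially"
      by (auto simp: filterlim_at)
    then have "\<forall>\<^sub>F n in sequentially. good (X n)"
      using good by (simp add: filterlim_iff)
    then obtain N where N: "\<And>n. n \<ge> N \<Longrightarrow> good (X n)"
      by (auto simp: eventually_sequentially)
    \<comment> \<open>Domination holds only eventually, so the sequence is shifted past its
      exceptions.\<close>
    have "filterlim (\<lambda>n. X (n + N)) (at x within S) sequentially"
      by (rule filterlim_compose[OF X]) (rule filterlim_add_const_nat_at_top)
    then have "(\<lambda>n. W (g (X (n + N)))) \<longlonglongrightarrow> W g0"
      using limX[of "\<lambda>n. X (n + N)"] N by simp
    then show "((\<lambda>s. W (g s)) \<circ> X) \<longlonglongrightarrow> W g0"
      by (simp add: o_def LIMSEQ_offset)
  qed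
qed

end

section \<open>The unitary group generated by a multiplication operator\<close>

lemma unitary_map_norm:
  assumes "unitary_map V"
  shows "norm (V x) = norm x"
proof -
  have "cinner (V x) (V x) = cinner x x"
    using assms by (simp add: unitary_map_def)
  then have "(norm (V x))\<^sup>2 = (norm x)\<^sup>2"
    unfolding cinner_self by (simp only: of_real_eq_iff)
  then show ?thesis by (simp add: power2_eq_iff_nonneg)
qed

lemma unitary_map_bounded_linear:
  assumes V: "unitary_map V"
  shows "bounded_linear V"
proof
  show "V (x + y) = V x + V y" for x y
    using V by (simp add: unitary_map_def)
  show "V (r *\<^sub>R x) = r *\<^sub>R V x" for r x
    using V unfolding unitary_map_def by (metis scaleC_of_real)
  show "\<exists>K. \<forall>x. norm (V x) \<le> norm x * K"
    by (rule exI[of _ 1]) (simp add: unitary_map_norm[OF V])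
qed

text \<open>The group law carries the derivative from 0 to t. Applied to the generator, the second
  form says that V t preserves its domain and commutes with it.\<close>

lemma unitary_group_derivative:
  assumes V: "unitary_group V" and der: "((\<lambda>t. V t \<phi>) has_vector_derivative \<psi>) (at 0)"
  shows "((\<lambda>s. V s \<phi>) has_vector_derivative V t \<psi>) (at t)"
    and "((\<lambda>s. V s (V t \<phi>)) has_vector_derivative V t \<psi>) (at 0)"
proof -
  have add: "V (s + t) = V s \<circ> V t" for s t
    using V by (simp add: unitary_group_def)
  have lin: "bounded_linear (V t)"
    using V by (simp add: unitary_group_def unitary_map_bounded_linear)
  have "((\<lambda>s. V t (V s \<phi>)) has_vector_derivative V t \<psi>) (at 0)"
    by (rule bounded_linear.has_vector_derivative[OF lin der])
  moreover have "V t (V s \<phi>) = V s (V t \<phi>)" for s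
    using add[of t s] add[of s t] by (metis add.commute comp_apply)
  ultimately show "((\<lambda>s. V s (V t \<phi>)) has_vector_derivative V t \<psi>) (at 0)"
    by simp
  moreover have "((\<lambda>s. s - t) has_vector_derivative 1) (at t)"
    by (auto intro!: derivative_eq_intros)
  ultimately have "((\<lambda>s. V (s - t) (V t \<phi>)) has_vector_derivative V t \<psi>) (at t)"
    using vector_diff_chain_at[of "\<lambda>s. s - t" 1 t "\<lambda>s. V s (V t \<phi>)"] by (simp add: o_def)
  moreover have "V (s - t) (V t \<phi>) = V s \<phi>" for s
    using add[of "s - t" t] by simp
  ultimately show "((\<lambda>s. V s \<phi>) has_vector_derivative V t \<psi>) (at t)"
    by simp
qed

text \<open>Brings the derivative into the form of a limit to which \<open>W_tendsto\<close>
  applies.\<close>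

lemma has_vector_derivative_iff_quotient:
  "(f has_vector_derivative D) (at t) \<longleftrightarrow> ((\<lambda>s. (f s - f t) /\<^sub>R (s - t)) \<longlongrightarrow> D) (at t)"
proof -
  have "norm (f s - f t - (s - t) *\<^sub>R D) / norm (s - t) = norm ((f s - f t) /\<^sub>R (s - t) - D)"
    if "s \<noteq> t" for s
  proof -
    have "(f s - f t) /\<^sub>R (s - t) - D = (f s - f t - (s - t) *\<^sub>R D) /\<^sub>R (s - t)"
      using that by (simp add: scaleR_diff_right)
    then show ?thesis by (simp add: divide_inverse mult.commute)
  qed
  then have "((\<lambda>s. norm (f s - f t - (s - t) *\<^sub>R D) / norm (s - t)) \<longlongrightarrow> 0) (at t)
      \<longleftrightarrow> ((\<lambda>s. norm ((f s - f t) /\<^sub>R (s - t) - D)) \<longlongrightarrow> 0) (at t)"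
    by (intro filterlim_cong) (auto simp: eventually_at_filter)
  then show ?thesis
    unfolding has_vector_derivative_def has_derivative_iff_norm tendsto_norm_zero_iff LIM_zero_iff
    by (simp add: bounded_linear_scaleR_left)
qed

lemma iexp_derivative:
  fixes x :: real
  shows "((\<lambda>s. exp (- \<i> * of_real (s * x))) has_vector_derivative
    - \<i> * of_real x * exp (- \<i> * of_real (t * x))) (at t)"
proof -
  have "((\<lambda>s. - \<i> * of_real (s * x)) has_vector_derivative - \<i> * of_real x) (at t)"
    unfolding has_vector_derivative_complex_iff by (auto intro!: derivative_eq_intros)
  from field_vector_diff_chain_at[OF this DERIV_exp] show ?thesis
    by (simp add: o_def)
qed

text \<open>The mean value inequality; it dominates the difference quotients uniformly in s.\<close>

lemma norm_iexp_diff_le: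
  fixes x :: real
  shows "cmod (exp (- \<i> * of_real (s * x)) - exp (- \<i> * of_real (t * x))) \<le> \<bar>s - t\<bar> * \<bar>x\<bar>"
proof -
  have "cmod (exp (- \<i> * of_real (s * x)) - exp (- \<i> * of_real (t * x))) \<le> \<bar>x\<bar> * norm (s - t)"
  proof (rule differentiable_bound[where f = "\<lambda>s. exp (- \<i> * of_real (s * x))" and S = UNIV])
    fix s :: real
    show "((\<lambda>s. exp (- \<i> * of_real (s * x))) has_derivative
        (\<lambda>h. h *\<^sub>R (- \<i> * of_real x * exp (- \<i> * of_real (s * x))))) (at s within UNIV)"
      using iexp_derivative[of x s] by (simp only: has_vector_derivative_def)
    show "onorm (\<lambda>h. h *\<^sub>R (- \<i> * of_real x * exp (- \<i> * of_real (s * x)))) \<le> \<bar>x\<bar>"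
      by (rule onorm_bound) (simp_all add: norm_mult)
  qed auto
  then show ?thesis by (simp add: mult.commute)
qed

section \<open>The multiplication group exp (- i t a) and its identification with exp (- i t
  A)\<close>

context L2_model
begin

definition evolve :: "('w \<Rightarrow> real) \<Rightarrow> real \<Rightarrow> ('w \<Rightarrow> complex) \<Rightarrow> 'w \<Rightarrow> complex" where
  "evolve a t f = (\<lambda>\<omega>. exp (- \<i> * of_real (t * a \<omega>)) * f \<omega>)"

lemma norm_evolve: "cmod (evolve a t f \<omega>) = cmod (f \<omega>)"
  by (simp add: evolve_def norm_mult)

lemma evolve_L2:
  assumes a: "a \<in> borel_measurable M" and f: "f \<in> L2 M"
  shows "evolve a t f \<in> L2 M"
proof (rule L2_dominated[OF f])
  have [measurable]: "a \<in> borel_measurable M" "f \<in> borel_measurable M"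
    using a f by (auto simp: L2_def)
  show "evolve a t f \<in> borel_measurable M"
    unfolding evolve_def by measurable
qed (simp add: norm_evolve)

text \<open>The difference quotients are dominated by |a f|, which is square integrable exactly when
  W f lies in the domain of the operator represented by a.\<close>

lemma evolve_derivative:
  assumes a: "a \<in> borel_measurable M" and f: "f \<in> L2 M" and af: "(\<lambda>\<omega>. complex_of_real (a \<omega>) * f \<omega>) \<in> L2 M"
  shows "((\<lambda>s. W (evolve a s f)) has_vector_derivative
    W (\<lambda>\<omega>. - \<i> * evolve a t (\<lambda>\<omega>. complex_of_real (a \<omega>) * f \<omega>) \<omega>)) (at t)"
proof -
  define q where "q s \<omega> = of_real (1 / (s - t)) * (evolve a s f \<omega> - evolve a t f \<omega>)" for s \<omega>
  have [measurable]: "a \<in> borel_measurable M" "f \<in> borel_measurable M"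
    using a f by (auto simp: L2_def)
  have q_L2: "q s \<in> L2 M" for s
    unfolding q_def by (intro L2_scale L2_diff evolve_L2 a f)
  have "((\<lambda>s. W (q s)) \<longlongrightarrow> W (\<lambda>\<omega>. - \<i> * evolve a t (\<lambda>\<omega>. complex_of_real (a \<omega>) * f \<omega>) \<omega>)) (at t)"
  proof (rule W_tendsto[OF af])
    show "\<forall>\<^sub>F s in at t. q s \<in> borel_measurable M \<and>
        (AE \<omega> in M. cmod (q s \<omega>) \<le> cmod (complex_of_real (a \<omega>) * f \<omega>))"
      using eventually_neq_at_within[of t t UNIV]
    proof eventually_elim
      case (elim s)
      have "cmod (q s \<omega>) \<le> cmod (complex_of_real (a \<omega>) * f \<omega>)" for \<omega>
      proof -
        have "cmod (q s \<omega>) = cmod (exp (- \<i> * of_real (s * a \<omega>)) - exp (- \<i> * of_real (t * a \<omega>)))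
            / \<bar>s - t\<bar> * cmod (f \<omega>)"
          by (simp add: q_def evolve_def left_diff_distrib[symmetric] norm_mult norm_divide
              del: of_real_diff flip: of_real_diff)
        also have "\<dots> \<le> \<bar>a \<omega>\<bar> * cmod (f \<omega>)"
          using norm_iexp_diff_le[of s "a \<omega>" t] elim
          by (intro mult_right_mono) (simp_all add: divide_le_eq mult.commute)
        finally show ?thesis by (simp add: norm_mult)
      qed
      then show ?case using q_L2[of s] by (simp add: L2_def)
    qed
    show "AE \<omega> in M. ((\<lambda>s. q s \<omega>) \<longlongrightarrow> - \<i> * evolve a t (\<lambda>\<omega>. complex_of_real (a \<omega>) * f \<omega>) \<omega>) (at t)"
    proof (rule AE_I2)
      fix \<omega>
      have "((\<lambda>s. (exp (- \<i> * of_real (s * a \<omega>)) - exp (- \<i> * of_real (t * a \<omega>))) /\<^sub>R (s - t))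
          \<longlongrightarrow> - \<i> * of_real (a \<omega>) * exp (- \<i> * of_real (t * a \<omega>))) (at t)"
        using iexp_derivative[of "a \<omega>" t] by (simp only: has_vector_derivative_iff_quotient)
      from tendsto_mult_right[OF this, of "f \<omega>"]
      show "((\<lambda>s. q s \<omega>) \<longlongrightarrow> - \<i> * evolve a t (\<lambda>\<omega>. complex_of_real (a \<omega>) * f \<omega>) \<omega>) (at t)"
        by (simp add: q_def evolve_def scaleR_conv_of_real divide_inverse algebra_simps)
    qed
  qed (simp add: evolve_def)
  moreover have "W (q s) = (W (evolve a s f) - W (evolve a t f)) /\<^sub>R (s - t)" for s
    unfolding q_def
    by (simp only: W_scale[OF L2_diff[OF evolve_L2[OF a f] evolve_L2[OF a f]]]
        W_diff[OF evolve_L2[OF a f] evolve_L2[OF a f]] scaleC_of_real inverse_eq_divide)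
  ultimately show ?thesis
    by (simp only: has_vector_derivative_iff_quotient)
qed

text \<open>On the domain of A both orbits keep the norm of \<phi>, so they coincide if their real
  inner product keeps its initial value. Its derivative vanishes because - i A is skew-symmetric.
  Density and isometry extend the identity to all vectors.\<close>

theorem unitary_group_eq_evolve:
  assumes A: "densely_defined A" and rep_A: "spectral_representation A M a W"
    and V: "generated_unitary_group A V"
  shows "V t \<phi> = W (evolve a t (rep \<phi>))"
proof -
  have a: "a \<in> borel_measurable M"
    and dom_A: "\<And>f. f \<in> L2 M \<Longrightarrow> W f \<in> dom A \<longleftrightarrow> (\<lambda>\<omega>. complex_of_real (a \<omega>) * f \<omega>) \<in> L2 M"
    and A_W: "\<And>f. f \<in> L2 M \<Longrightarrow> W f \<in> dom A \<Longrightarrow> A (W f) = Some (W (\<lambda>\<omega>. complex_of_real (a \<omega>) * f \<omega>))"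
    using rep_A by (auto simp: spectral_representation_def)
  have group: "unitary_group V"
    and gen: "\<And>\<phi> \<psi>. A \<phi> = Some \<psi> \<longleftrightarrow> ((\<lambda>t. V t \<phi>) has_vector_derivative (- \<i>) *\<^sub>C \<psi>) (at 0)"
    using V by (auto simp: generated_unitary_group_def)
  have unitary_V: "unitary_map (V t)" for t
    using group by (simp add: unitary_group_def)
  have V_scale: "V t (c *\<^sub>C x) = c *\<^sub>C V t x" for t c x
    using unitary_V by (simp add: unitary_map_def)
  have V_0: "V 0 = id"
    using group by (simp add: unitary_group_def)
  have norm_u: "norm (W (evolve a t f)) = norm (W f)" if "f \<in> L2 M" for t f
    using that by (intro norm_W_cong evolve_L2 a) (simp_all add: norm_evolve)
  have on_dom: "V t \<phi> = W (evolve a t (rep \<phi>))" if \<phi>: "\<phi> \<in> dom A" for \<phi> t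
  proof -
    define f where "f = rep \<phi>"
    define af where "af = (\<lambda>\<omega>. complex_of_real (a \<omega>) * f \<omega>)"
    have f: "f \<in> L2 M" and Wf: "W f = \<phi>"
      by (simp_all add: f_def rep)
    have af: "af \<in> L2 M"
      using dom_A[OF f] \<phi> Wf by (simp add: af_def)
    have A_\<phi>: "A \<phi> = Some (W af)"
      using A_W[OF f] \<phi> Wf by (simp add: af_def)
    define u where "u t = W (evolve a t f)" for t
    define u' where "u' t = W (\<lambda>\<omega>. - \<i> * evolve a t af \<omega>)" for t
    have der_u: "(u has_vector_derivative u' t) (at t)" for t
      unfolding u_def u'_def af_def by (rule evolve_derivative[OF a f af[unfolded af_def]])
    have der_0: "((\<lambda>t. V t \<phi>) has_vector_derivative (- \<i>) *\<^sub>C W af) (at 0)"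
      using A_\<phi> gen by simp
    have der_V: "((\<lambda>s. V s \<phi>) has_vector_derivative V t ((- \<i>) *\<^sub>C W af)) (at t)" for t
      by (rule unitary_group_derivative[OF group der_0])
    have orth: "V t \<phi> \<bullet> u' t + V t ((- \<i>) *\<^sub>C W af) \<bullet> u t = 0" for t
    proof -
      \<comment> \<open>The orbit stays in the domain of A, so on a representative of V t \<phi> the
        operator A also acts as multiplication by a.\<close>
      define g where "g = rep (V t \<phi>)"
      define ag where "ag = (\<lambda>\<omega>. complex_of_real (a \<omega>) * g \<omega>)"
      have g: "g \<in> L2 M" and Wg: "W g = V t \<phi>"
        by (simp_all add: g_def rep)
      have "((\<lambda>s. V s (V t \<phi>)) has_vector_derivative (- \<i>) *\<^sub>C V t (W af)) (at 0)"
        using unitary_group_derivative(2)[OF group der_0] by (simp only: V_scale)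
      then have A_V: "A (V t \<phi>) = Some (V t (W af))"
        using gen by simp
      then have V_dom: "W g \<in> dom A"
        by (auto simp: Wg)
      then have ag: "ag \<in> L2 M"
        using dom_A[OF g] by (simp add: ag_def)
      have "V t (W af) = W ag"
        using A_W[OF g V_dom] A_V by (simp add: Wg ag_def)
      then have "V t ((- \<i>) *\<^sub>C W af) = W (\<lambda>\<omega>. - \<i> * ag \<omega>)"
        by (simp only: V_scale W_scale[OF ag])
      then have "cinner (V t ((- \<i>) *\<^sub>C W af)) (u t)
          = (LINT \<omega>|M. (- \<i> * ag \<omega>) * cnj (evolve a t f \<omega>))"
        unfolding u_def by (simp only: W_cinner[OF L2_scale[OF ag] evolve_L2[OF a f]])
      \<comment> \<open>As a is real, the factor - i a changes sign when it moves to the conjugated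
        argument.\<close>
      also have "\<dots> = (LINT \<omega>|M. - (g \<omega> * cnj (- \<i> * evolve a t af \<omega>)))"
        by (rule Bochner_Integration.integral_cong) (simp_all add: ag_def af_def evolve_def mult_ac)
      also have "\<dots> = - cinner (V t \<phi>) (u' t)"
        unfolding u'_def Wg[symmetric]
        by (simp only: W_cinner[OF g L2_scale[OF evolve_L2[OF a af]]] integral_minus)
      finally show ?thesis
        by (simp add: inner_eq_Re_cinner)
    qed
    have "((\<lambda>t. V t \<phi> \<bullet> u t) has_real_derivative 0) (at t)" for t
    proof -
      have "((\<lambda>t. V t \<phi> \<bullet> u t) has_vector_derivative V t \<phi> \<bullet> u' t + V t ((- \<i>) *\<^sub>C W af) \<bullet> u t) (at t)"
        by (rule bounded_bilinear.has_vector_derivative[OF bounded_bilinear_inner der_V der_u])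
      then show ?thesis
        by (simp only: orth has_real_derivative_iff_has_vector_derivative)
    qed
    then have "V t \<phi> \<bullet> u t = V 0 \<phi> \<bullet> u 0"
      using DERIV_isconst_all by blast
    also have "u 0 = \<phi>"
      by (simp add: u_def evolve_def Wf)
    finally have "V t \<phi> \<bullet> u t = (norm \<phi>)\<^sup>2"
      by (simp add: V_0 power2_norm_eq_inner)
    moreover have "norm (V t \<phi>) = norm \<phi>" "norm (u t) = norm \<phi>"
      using norm_u[OF f, of t] by (simp_all add: unitary_map_norm[OF unitary_V] u_def Wf)
    moreover have "(norm (V t \<phi> - u t))\<^sup>2 = (norm (V t \<phi>))\<^sup>2 + (norm (u t))\<^sup>2 - 2 * (V t \<phi> \<bullet> u t)"
      by (simp add: power2_norm_eq_inner inner_diff_left inner_diff_right inner_commute)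
    ultimately have "(norm (V t \<phi> - u t))\<^sup>2 = 0"
      by simp
    then show ?thesis
      by (simp add: u_def f_def)
  qed
  \<comment> \<open>The choice \<open>rep\<close> need not be additive, but \<open>W\<close>
    restores linearity: the map is isometric, hence continuous, and the vectors on which both sides
    agree form a closed set.\<close>
  have "continuous_on UNIV (\<lambda>\<phi>. W (evolve a t (rep \<phi>)))"
  proof -
    have "dist (W (evolve a t (rep \<phi>))) (W (evolve a t (rep \<psi>))) = dist \<phi> \<psi>" for \<phi> \<psi>
    proof -
      have "W (evolve a t (rep \<phi>)) - W (evolve a t (rep \<psi>)) = W (evolve a t (\<lambda>\<omega>. rep \<phi> \<omega> - rep \<psi> \<omega>))"
        unfolding W_diff[OF evolve_L2[OF a rep(1)] evolve_L2[OF a rep(1)], symmetric]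
        by (simp add: evolve_def right_diff_distrib)
      also have "norm \<dots> = norm (\<phi> - \<psi>)"
        by (simp add: norm_u L2_diff rep W_diff)
      finally show ?thesis by (simp add: dist_norm)
    qed
    then show ?thesis by (auto simp: continuous_on_iff)
  qed
  then have "closed {\<phi>. V t \<phi> = W (evolve a t (rep \<phi>))}"
    using unitary_map_bounded_linear[OF unitary_V]
    by (intro closed_Collect_eq) (auto intro: linear_continuous_on)
  then have "closure (dom A) \<subseteq> {\<phi>. V t \<phi> = W (evolve a t (rep \<phi>))}"
    using on_dom by (intro closure_minimal) auto
  then show ?thesis
    using A by (auto simp: densely_defined_def)
qed

end

section \<open>The solution operators\<close>

text \<open>The bound on the critical ray as a function of \<alpha> alone. It stays finite as
  \<alpha> tends to 1, where the sine tends to 1.\<close>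

definition mittag_leffler_const :: "real \<Rightarrow> real" where
  "mittag_leffler_const \<alpha> = 1 / \<alpha> + (4 / \<alpha> + 1 / sin (\<alpha> * pi / 2)) * (exp (exp 2) + 1)"

lemma tendsto_mittag_leffler_const:
  "(mittag_leffler_const \<longlongrightarrow> mittag_leffler_const 1) (at_left 1)"
  unfolding mittag_leffler_const_def[abs_def] by (intro tendsto_intros) auto

lemma minus_it_powr_mult:
  "minus_it_powr t \<alpha> * of_real x = exp (- \<i> * of_real (\<alpha> * pi / 2)) * of_real (t powr \<alpha> * x)"
  by (simp add: minus_it_powr_def)

lemma it_powr_mult: "it_powr t \<alpha> * of_real x = cnj (minus_it_powr t \<alpha> * of_real x)"
  by (simp add: it_powr_def minus_it_powr_def exp_cnj)

lemma mittag_leffler_ray_bound: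
  assumes "0 < \<alpha>" "\<alpha> < 1" "0 \<le> x"
  shows "cmod (mittag_leffler \<alpha> (minus_it_powr t \<alpha> * of_real x)) \<le> mittag_leffler_const \<alpha>"
  unfolding minus_it_powr_mult mittag_leffler_const_def
  using assms by (intro mittag_leffler_bound) auto

lemma bounded_multiplier_mittag_leffler:
  assumes a: "a \<in> borel_measurable M" "AE \<omega> in M. 0 \<le> a \<omega>" and \<alpha>: "0 < \<alpha>" "\<alpha> < 1"
  shows "bounded_multiplier M (\<lambda>\<omega>. mittag_leffler \<alpha> (minus_it_powr t \<alpha> * complex_of_real (a \<omega>)))"
  unfolding bounded_multiplier_def
proof (intro conjI exI)
  have [measurable]: "a \<in> borel_measurable M" by (rule a)
  show "(\<lambda>\<omega>. mittag_leffler \<alpha> (minus_it_powr t \<alpha> * complex_of_real (a \<omega>))) \<in> borel_measurable M"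
    by (rule measurable_compose[OF _ borel_measurable_continuous_onI[OF continuous_on_mittag_leffler[OF \<alpha>(1)]]])
      measurable
  show "AE \<omega> in M. cmod (mittag_leffler \<alpha> (minus_it_powr t \<alpha> * complex_of_real (a \<omega>))) \<le> mittag_leffler_const \<alpha>"
    using a(2) by eventually_elim (rule mittag_leffler_ray_bound[OF \<alpha>])
qed

context L2_model
begin

text \<open>The multipliers converge pointwise and are bounded by a constant near \<alpha> = 1, so a
  multiple of |rep \<phi>| dominates.\<close>

lemma tendsto_solution_operator:
  assumes a: "a \<in> borel_measurable M" "AE \<omega> in M. 0 \<le> a \<omega>" and t: "0 \<le> t"
  shows "((\<lambda>\<alpha>. the (solution_operator M a W \<alpha> t \<phi>)) \<longlongrightarrow> W (evolve a t (rep \<phi>))) (at_left 1)"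
proof -
  define g where "g \<alpha> \<omega> = mittag_leffler \<alpha> (minus_it_powr t \<alpha> * complex_of_real (a \<omega>)) * rep \<phi> \<omega>" for \<alpha> \<omega>
  \<comment> \<open>Strictly above the limit of the bounds, hence above the bounds themselves for
    \<alpha> close to 1.\<close>
  define K where "K = mittag_leffler_const 1 + 1"
  have mult: "bounded_multiplier M (\<lambda>\<omega>. mittag_leffler \<alpha> (minus_it_powr t \<alpha> * complex_of_real (a \<omega>)))"
    if "0 < \<alpha>" "\<alpha> < 1" for \<alpha>
    using a that by (rule bounded_multiplier_mittag_leffler)
  have near_1: "\<forall>\<^sub>F \<alpha> in at_left 1. 0 < \<alpha> \<and> \<alpha> < (1 :: real)"
    by (rule eventually_at_leftI[of 0]) auto
  have "\<forall>\<^sub>F \<alpha> in at_left 1. mittag_leffler_const \<alpha> < K"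
    using tendsto_mittag_leffler_const by (rule order_tendstoD) (simp add: K_def)
  with near_1 have dominated: "\<forall>\<^sub>F \<alpha> in at_left 1. g \<alpha> \<in> borel_measurable M \<and>
      (AE \<omega> in M. cmod (g \<alpha> \<omega>) \<le> cmod (complex_of_real K * rep \<phi> \<omega>))"
  proof eventually_elim
    case (elim \<alpha>)
    have "g \<alpha> \<in> L2 M"
      using L2_multiplier[OF mult rep(1)] elim by (simp add: g_def[abs_def])
    moreover have "AE \<omega> in M. cmod (g \<alpha> \<omega>) \<le> cmod (complex_of_real K * rep \<phi> \<omega>)"
      using a(2)
    proof eventually_elim
      fix \<omega> assume "0 \<le> a \<omega>"
      then have "cmod (mittag_leffler \<alpha> (minus_it_powr t \<alpha> * complex_of_real (a \<omega>))) \<le> \<bar>K\<bar>"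
        using mittag_leffler_ray_bound[of \<alpha> "a \<omega>" t] elim by linarith
      then show "cmod (g \<alpha> \<omega>) \<le> cmod (complex_of_real K * rep \<phi> \<omega>)"
        by (simp add: g_def norm_mult mult_right_mono)
    qed
    ultimately show ?case by (simp add: L2_def)
  qed
  have "((\<lambda>\<alpha>. W (g \<alpha>)) \<longlongrightarrow> W (evolve a t (rep \<phi>))) (at_left 1)"
  proof (rule W_tendsto[OF L2_scale[OF rep(1), of "complex_of_real K"] _ dominated])
    show "evolve a t (rep \<phi>) \<in> borel_measurable M"
      using evolve_L2[OF a(1) rep(1)] by (simp add: L2_def)
    show "AE \<omega> in M. ((\<lambda>\<alpha>. g \<alpha> \<omega>) \<longlongrightarrow> evolve a t (rep \<phi>) \<omega>) (at_left 1)"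
    proof (rule AE_I2)
      fix \<omega>
      \<comment> \<open>Base 0 is separate: \<open>0 powr \<alpha>\<close> is constantly 0, while
        for nonzero t continuity in the exponent applies.\<close>
      have "((\<lambda>\<alpha>. t powr \<alpha>) \<longlongrightarrow> t) (at_left 1)"
      proof (cases "t = 0")
        case False
        then have "((\<lambda>\<alpha>. t powr \<alpha>) \<longlongrightarrow> t powr 1) (at_left 1)"
          by (intro tendsto_intros) auto
        then show ?thesis using t by simp
      qed simp
      then have "((\<lambda>\<alpha>. exp (- \<i> * of_real (\<alpha> * pi / 2)) * of_real (t powr \<alpha> * a \<omega>))
          \<longlongrightarrow> exp (- \<i> * of_real (1 * pi / 2)) * of_real (t * a \<omega>)) (at_left 1)"
        by (intro tendsto_intros) auto
      moreover have "exp (- \<i> * of_real (1 * pi / 2)) = - \<i>"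
        by (simp add: complex_eq_iff Re_exp Im_exp)
      ultimately have "((\<lambda>\<alpha>. minus_it_powr t \<alpha> * of_real (a \<omega>)) \<longlongrightarrow> - \<i> * of_real (t * a \<omega>)) (at_left 1)"
        by (simp only: minus_it_powr_mult)
      from tendsto_mult_right[OF tendsto_mittag_leffler_1[OF this]]
      show "((\<lambda>\<alpha>. g \<alpha> \<omega>) \<longlongrightarrow> evolve a t (rep \<phi>) \<omega>) (at_left 1)"
        by (simp only: g_def evolve_def)
    qed
  qed
  \<comment> \<open>For \<alpha> in (0, 1) the operator is defined everywhere, so \<open>the\<close>
    returns its actual value.\<close>
  moreover have "\<forall>\<^sub>F \<alpha> in at_left 1. W (g \<alpha>) = the (solution_operator M a W \<alpha> t \<phi>)"
    using near_1
  proof eventually_elim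
    case (elim \<alpha>)
    then show ?case
      unfolding solution_operator_def g_def[abs_def] by (simp add: mult_operator_rep[OF mult])
  qed
  ultimately show ?thesis
    by (rule Lim_transform_eventually)
qed

end

text \<open>The clause on domains gives \<open>the\<close> in the limit clause its meaning. The
  group exp (- i t A) enters as any \<open>V\<close> whose generator in the sense of Stone is
  \<open>A\<close>.\<close>

theorem proposition2:
  fixes A :: "'h::complex_hilbert_space operator"
    and M :: "'w measure" and a :: "'w \<Rightarrow> real" and W :: "('w \<Rightarrow> complex) \<Rightarrow> 'h"
  assumes "positive_self_adjoint A"
    and "spectral_representation A M a W"
  shows
    "(\<forall>\<alpha>\<in>{0<..<1}. \<forall>t\<ge>0. dom (solution_operator M a W \<alpha> t) = UNIV) \<and>
     (\<forall>\<alpha>\<in>{0<..<1}. \<forall>t>0.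
        op_adjoint (solution_operator M a W \<alpha> t) =
          mult_operator M W (\<lambda>\<omega>. mittag_leffler \<alpha> (it_powr t \<alpha> * complex_of_real (a \<omega>)))) \<and>
     (\<forall>\<alpha>\<in>{0<..<1}. \<forall>t>0.
        solution_operator M a W \<alpha> t \<circ>\<^sub>m op_adjoint (solution_operator M a W \<alpha> t) =
          op_adjoint (solution_operator M a W \<alpha> t) \<circ>\<^sub>m solution_operator M a W \<alpha> t \<and>
        op_adjoint (solution_operator M a W \<alpha> t) \<circ>\<^sub>m solution_operator M a W \<alpha> t =
          mult_operator M W (\<lambda>\<omega>. complex_of_real
            ((cmod (mittag_leffler \<alpha> (it_powr t \<alpha> * complex_of_real (a \<omega>))))\<^sup>2))) \<and>
     (\<forall>V. generated_unitary_group A V \<longrightarrow>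
        (\<forall>\<phi>. \<forall>t\<ge>0.
           ((\<lambda>\<alpha>. the (solution_operator M a W \<alpha> t \<phi>)) \<longlongrightarrow> V t \<phi>) (at_left 1)))"
proof -
  have a: "a \<in> borel_measurable M" "AE \<omega> in M. 0 \<le> a \<omega>" and "unitary_L2 M W"
    using assms(2) by (auto simp: spectral_representation_def)
  then interpret L2_model M W by unfold_locales
  define m where "m \<alpha> t = (\<lambda>\<omega>. mittag_leffler \<alpha> (minus_it_powr t \<alpha> * complex_of_real (a \<omega>)))" for \<alpha> t
  have U: "solution_operator M a W \<alpha> t = mult_operator M W (m \<alpha> t)" for \<alpha> t
    by (simp add: solution_operator_def m_def)
  have m: "bounded_multiplier M (m \<alpha> t)" if "\<alpha> \<in> {0<..<1}" for \<alpha> t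
    unfolding m_def using a that by (intro bounded_multiplier_mittag_leffler) auto
  \<comment> \<open>Conjugating the argument conjugates the value, so the multiplier with (i
    t)^\<alpha> is the one of the adjoint.\<close>
  have cnj_m: "mittag_leffler \<alpha> (it_powr t \<alpha> * complex_of_real (a \<omega>)) = cnj (m \<alpha> t \<omega>)"
    if "\<alpha> \<in> {0<..<1}" for \<alpha> t \<omega>
    unfolding it_powr_mult m_def using that by (intro mittag_leffler_cnj) auto
  have adjoint: "op_adjoint (solution_operator M a W \<alpha> t) = mult_operator M W (\<lambda>\<omega>. cnj (m \<alpha> t \<omega>))"
    if "\<alpha> \<in> {0<..<1}" for \<alpha> t
    unfolding U by (rule op_adjoint_mult_operator[OF m[OF that]])
  have product: "solution_operator M a W \<alpha> t \<circ>\<^sub>m op_adjoint (solution_operator M a W \<alpha> t)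
        = mult_operator M W (\<lambda>\<omega>. complex_of_real ((cmod (m \<alpha> t \<omega>))\<^sup>2))"
    "op_adjoint (solution_operator M a W \<alpha> t) \<circ>\<^sub>m solution_operator M a W \<alpha> t
        = mult_operator M W (\<lambda>\<omega>. complex_of_real ((cmod (m \<alpha> t \<omega>))\<^sup>2))"
    if "\<alpha> \<in> {0<..<1}" for \<alpha> t
    unfolding adjoint[OF that] unfolding U complex_norm_square
    using mult_operator_comp[OF m[OF that] bounded_multiplier_cnj[OF m[OF that]]]
      mult_operator_comp[OF bounded_multiplier_cnj[OF m[OF that]] m[OF that]]
    by (simp_all add: mult.commute)
  have densely: "densely_defined A"
    using assms(1) by (simp add: positive_self_adjoint_def self_adjoint_def)
  show ?thesis
  proof (intro conjI ballI allI impI)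
    fix \<alpha> t :: real assume \<alpha>: "\<alpha> \<in> {0<..<1}"
    show "dom (solution_operator M a W \<alpha> t) = UNIV"
      unfolding U by (rule dom_mult_operator[OF m[OF \<alpha>]])
    show "op_adjoint (solution_operator M a W \<alpha> t) =
        mult_operator M W (\<lambda>\<omega>. mittag_leffler \<alpha> (it_powr t \<alpha> * complex_of_real (a \<omega>)))"
      unfolding adjoint[OF \<alpha>] cnj_m[OF \<alpha>] ..
    show "solution_operator M a W \<alpha> t \<circ>\<^sub>m op_adjoint (solution_operator M a W \<alpha> t) =
        op_adjoint (solution_operator M a W \<alpha> t) \<circ>\<^sub>m solution_operator M a W \<alpha> t"
      unfolding product[OF \<alpha>] ..
    show "op_adjoint (solution_operator M a W \<alpha> t) \<circ>\<^sub>m solution_operator M a W \<alpha> t =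
        mult_operator M W (\<lambda>\<omega>. complex_of_real
          ((cmod (mittag_leffler \<alpha> (it_powr t \<alpha> * complex_of_real (a \<omega>))))\<^sup>2))"
      unfolding product[OF \<alpha>] cnj_m[OF \<alpha>] complex_mod_cnj ..
  next
    fix V \<phi> and t :: real
    assume "generated_unitary_group A V" "0 \<le> t"
    then show "((\<lambda>\<alpha>. the (solution_operator M a W \<alpha> t \<phi>)) \<longlongrightarrow> V t \<phi>) (at_left 1)"
      using tendsto_solution_operator[OF a, of t \<phi>] unitary_group_eq_evolve[OF densely assms(2), of V t \<phi>] by simp
  qed
qed

end
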